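(* Work in ZFC. For any ordinal $\delta$ the following schemes are equivalent (each instance of one being provable from the other scheme): (1) $\mathrm{Val}_{\mathcal{V}}(V_\delta,\mathcal{L}^\Diamond_{\in,V_\delta})=\mathrm{S5}$, i.e. every substitution instance of every S5 theorem by assertions of the potentialist language $\mathcal{L}_\in^\Diamond$ with parameters from $V_\delta$ holds at $V_\delta$ in rank potentialism; (2) $\delta$ is a correct cardinal, i.e. $V_\delta\prec_{\Sigma_n}V$ for every natural number $n$ (the scheme $V_\delta\prec V$).
   Context: $\mathcal{V}=\{V_\beta\mid\beta\in\mathrm{Ord}\}$ is rank potentialism: worlds are the $V_\beta$, $V_\beta$ accesses $V_\gamma$ iff $\beta\le\gamma$; $\Diamond\varphi$ at $V_\beta$ means $\varphi$ holds at some $V_\gamma$, $\gamma\ge\beta$, $\Box\varphi$ at all such; quantifiers range over the current world. $\mathcal{L}_\in^\Diamond$ is the language of set theory augmented with $\Diamond,\Box$; the subscript $V_\delta$ allows parameters from $V_\delta$. $\mathrm{Val}_{\mathcal{V}}(W,\mathcal{L}')$ is the set of propositional modal formulas all of whose substitution instances by $\mathcal{L}'$-assertions are true at $W$. Since neither condition is a single first-order statement, the equivalence is a pair of theorem schemes. *)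

theory Defs
  imports Main
begin

section \<open>First-order set theory\<close>

text \<open>Variables are de Bruijn indices. The language has no function symbols, so every term is a
  variable and substitution is renaming of variables.\<close>

datatype fm =
    Mem nat nat  (infix \<open>\<^bold>\<in>\<close> 80)
  | Eq nat nat   (infix \<open>\<^bold>=\<close> 80)
  | Fls          (\<open>\<^bold>\<bottom>\<close>)
  | Imp fm fm    (infixr \<open>\<^bold>\<longrightarrow>\<close> 70)
  | All fm       (\<open>\<^bold>\<forall>_\<close> [75] 75)

abbreviation Neg :: "fm \<Rightarrow> fm" (\<open>\<^bold>\<not>_\<close> [75] 75) where
  "\<^bold>\<not>\<phi> \<equiv> \<phi> \<^bold>\<longrightarrow> \<^bold>\<bottom>"

abbreviation Con :: "fm \<Rightarrow> fm \<Rightarrow> fm" (infixr \<open>\<^bold>\<and>\<close> 73) where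
  "\<phi> \<^bold>\<and> \<psi> \<equiv> \<^bold>\<not>(\<phi> \<^bold>\<longrightarrow> \<^bold>\<not>\<psi>)"

abbreviation Dis :: "fm \<Rightarrow> fm \<Rightarrow> fm" (infixr \<open>\<^bold>\<or>\<close> 72) where
  "\<phi> \<^bold>\<or> \<psi> \<equiv> \<^bold>\<not>\<phi> \<^bold>\<longrightarrow> \<psi>"

abbreviation Iff :: "fm \<Rightarrow> fm \<Rightarrow> fm" (infix \<open>\<^bold>\<longleftrightarrow>\<close> 69) where
  "\<phi> \<^bold>\<longleftrightarrow> \<psi> \<equiv> (\<phi> \<^bold>\<longrightarrow> \<psi>) \<^bold>\<and> (\<psi> \<^bold>\<longrightarrow> \<phi>)"

abbreviation Exi :: "fm \<Rightarrow> fm" (\<open>\<^bold>\<exists>_\<close> [75] 75) where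
  "\<^bold>\<exists>\<phi> \<equiv> \<^bold>\<not>(\<^bold>\<forall>(\<^bold>\<not>\<phi>))"

primrec fv :: "fm \<Rightarrow> nat set" where
  "fv (x \<^bold>\<in> y) = {x, y}"
| "fv (x \<^bold>= y) = {x, y}"
| "fv \<^bold>\<bottom> = {}"
| "fv (\<phi> \<^bold>\<longrightarrow> \<psi>) = fv \<phi> \<union> fv \<psi>"
| "fv (\<^bold>\<forall>\<phi>) = {i. Suc i \<in> fv \<phi>}"

primrec rename :: "(nat \<Rightarrow> nat) \<Rightarrow> fm \<Rightarrow> fm" where
  "rename r (x \<^bold>\<in> y) = (r x \<^bold>\<in> r y)"
| "rename r (x \<^bold>= y) = (r x \<^bold>= r y)"
| "rename r \<^bold>\<bottom> = \<^bold>\<bottom>"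
| "rename r (\<phi> \<^bold>\<longrightarrow> \<psi>) = (rename r \<phi> \<^bold>\<longrightarrow> rename r \<psi>)"
| "rename r (\<^bold>\<forall>\<phi>) = \<^bold>\<forall>(rename (case_nat 0 (\<lambda>i. Suc (r i))) \<phi>)"

definition inst :: "nat \<Rightarrow> fm \<Rightarrow> fm" where
  "inst t \<phi> = rename (case_nat t (\<lambda>i. i)) \<phi>"

text \<open>Classical natural deduction with equality. Free variables of the assumptions act as
  constants: rule \<open>AllI\<close> frees index 0 by shifting all assumptions.\<close>

inductive deriv :: "fm set \<Rightarrow> fm \<Rightarrow> bool" (infix \<open>\<turnstile>\<close> 50) where
  Assm: "\<phi> \<in> \<Gamma> \<Longrightarrow> \<Gamma> \<turnstile> \<phi>"
| ImpI: "insert \<phi> \<Gamma> \<turnstile> \<psi> \<Longrightarrow> \<Gamma> \<turnstile> \<phi> \<^bold>\<longrightarrow> \<psi>"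
| ImpE: "\<Gamma> \<turnstile> \<phi> \<^bold>\<longrightarrow> \<psi> \<Longrightarrow> \<Gamma> \<turnstile> \<phi> \<Longrightarrow> \<Gamma> \<turnstile> \<psi>"
| Contr: "insert (\<^bold>\<not>\<phi>) \<Gamma> \<turnstile> \<^bold>\<bottom> \<Longrightarrow> \<Gamma> \<turnstile> \<phi>"
| AllI: "rename Suc ` \<Gamma> \<turnstile> \<phi> \<Longrightarrow> \<Gamma> \<turnstile> \<^bold>\<forall>\<phi>"
| AllE: "\<Gamma> \<turnstile> \<^bold>\<forall>\<phi> \<Longrightarrow> \<Gamma> \<turnstile> inst t \<phi>"
| EqRefl: "\<Gamma> \<turnstile> x \<^bold>= x"
| EqSubst: "\<Gamma> \<turnstile> x \<^bold>= y \<Longrightarrow> \<Gamma> \<turnstile> inst x \<phi> \<Longrightarrow> \<Gamma> \<turnstile> inst y \<phi>"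


section \<open>The axioms of ZFC\<close>

definition subset_fm :: "nat \<Rightarrow> nat \<Rightarrow> fm" where
  "subset_fm x y = \<^bold>\<forall>(0 \<^bold>\<in> Suc x \<^bold>\<longrightarrow> 0 \<^bold>\<in> Suc y)"

text \<open>\<open>s = x \<union> {x}\<close>\<close>

definition succ_fm :: "nat \<Rightarrow> nat \<Rightarrow> fm" where
  "succ_fm s x = \<^bold>\<forall>(0 \<^bold>\<in> Suc s \<^bold>\<longleftrightarrow> 0 \<^bold>\<in> Suc x \<^bold>\<or> 0 \<^bold>= Suc x)"

definition extensionality :: fm where
  "extensionality = \<^bold>\<forall>(\<^bold>\<forall>(\<^bold>\<forall>(0 \<^bold>\<in> 2 \<^bold>\<longleftrightarrow> 0 \<^bold>\<in> 1) \<^bold>\<longrightarrow> 1 \<^bold>= 0))"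

definition foundation :: fm where
  "foundation = \<^bold>\<forall>(\<^bold>\<exists>(0 \<^bold>\<in> 1) \<^bold>\<longrightarrow> \<^bold>\<exists>(0 \<^bold>\<in> 1 \<^bold>\<and> \<^bold>\<not>\<^bold>\<exists>(0 \<^bold>\<in> 1 \<^bold>\<and> 0 \<^bold>\<in> 2)))"

definition pairing :: fm where
  "pairing = \<^bold>\<forall>(\<^bold>\<forall>(\<^bold>\<exists>(\<^bold>\<forall>(0 \<^bold>\<in> 1 \<^bold>\<longleftrightarrow> 0 \<^bold>= 3 \<^bold>\<or> 0 \<^bold>= 2))))"

definition union_ax :: fm where
  "union_ax = \<^bold>\<forall>(\<^bold>\<exists>(\<^bold>\<forall>(0 \<^bold>\<in> 1 \<^bold>\<longleftrightarrow> \<^bold>\<exists>(0 \<^bold>\<in> 3 \<^bold>\<and> 1 \<^bold>\<in> 0))))"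

definition powerset :: fm where
  "powerset = \<^bold>\<forall>(\<^bold>\<exists>(\<^bold>\<forall>(0 \<^bold>\<in> 1 \<^bold>\<longleftrightarrow> subset_fm 0 2)))"

definition infinity :: fm where
  "infinity = \<^bold>\<exists>(\<^bold>\<exists>(0 \<^bold>\<in> 1 \<^bold>\<and> \<^bold>\<not>\<^bold>\<exists>(0 \<^bold>\<in> 1)) \<^bold>\<and>
                \<^bold>\<forall>(0 \<^bold>\<in> 1 \<^bold>\<longrightarrow> \<^bold>\<exists>(0 \<^bold>\<in> 2 \<^bold>\<and> succ_fm 0 1)))"

text \<open>Every family of nonempty pairwise disjoint sets has a selector.\<close>

definition choice :: fm where
  "choice = \<^bold>\<forall>(\<^bold>\<forall>(0 \<^bold>\<in> 1 \<^bold>\<longrightarrow> \<^bold>\<exists>(0 \<^bold>\<in> 1)) \<^bold>\<and>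
               \<^bold>\<forall>(\<^bold>\<forall>(1 \<^bold>\<in> 2 \<^bold>\<and> 0 \<^bold>\<in> 2 \<^bold>\<and> \<^bold>\<exists>(0 \<^bold>\<in> 2 \<^bold>\<and> 0 \<^bold>\<in> 1) \<^bold>\<longrightarrow> 1 \<^bold>= 0))
              \<^bold>\<longrightarrow> \<^bold>\<exists>(\<^bold>\<forall>(0 \<^bold>\<in> 2 \<^bold>\<longrightarrow> \<^bold>\<exists>(\<^bold>\<forall>(0 \<^bold>\<in> 2 \<^bold>\<and> 0 \<^bold>\<in> 3 \<^bold>\<longleftrightarrow> 0 \<^bold>= 1)))))"

text \<open>Separation: \<open>\<forall>a. \<exists>b. \<forall>z. z \<in> b \<longleftrightarrow> z \<in> a \<and> \<phi>(z, a, \<dots>)\<close>, with \<open>z\<close> the variable 0 of \<open>\<phi>\<close>,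
  \<open>a\<close> its variable 1, and parameters from 2 on.\<close>

definition separation :: "fm \<Rightarrow> fm" where
  "separation \<phi> = \<^bold>\<forall>(\<^bold>\<exists>(\<^bold>\<forall>(0 \<^bold>\<in> 1 \<^bold>\<longleftrightarrow> 0 \<^bold>\<in> 2 \<^bold>\<and> rename (case_nat 0 (\<lambda>i. i + 2)) \<phi>)))"

text \<open>Replacement: if \<open>\<phi>(y, x, a, \<dots>)\<close> is functional in \<open>x \<in> a\<close>, then the image of \<open>a\<close> is a set.
  Here \<open>y\<close> is the variable 0 of \<open>\<phi>\<close>, \<open>x\<close> its variable 1, \<open>a\<close> its variable 2, and parameters
  follow from 3 on.\<close>

definition replacement :: "fm \<Rightarrow> fm" where
  "replacement \<phi> = \<^bold>\<forall>(
     \<^bold>\<forall>(0 \<^bold>\<in> 1 \<^bold>\<longrightarrow> \<^bold>\<forall>(\<^bold>\<forall>(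
        rename Suc \<phi> \<^bold>\<and> rename (case_nat 0 (\<lambda>i. i + 2)) \<phi> \<^bold>\<longrightarrow> 1 \<^bold>= 0)))
     \<^bold>\<longrightarrow> \<^bold>\<exists>(\<^bold>\<forall>(0 \<^bold>\<in> 1 \<^bold>\<longleftrightarrow>
        \<^bold>\<exists>(0 \<^bold>\<in> 3 \<^bold>\<and> rename (case_nat 1 (case_nat 0 (\<lambda>i. i + 3))) \<phi>))))"

text \<open>Schema instances enter through their universal closures, so all axioms are sentences.\<close>

definition ZFC :: "fm set" where
  "ZFC = {extensionality, foundation, pairing, union_ax, powerset, infinity, choice}
     \<union> {\<psi>. fv \<psi> = {} \<and> (\<exists>n \<phi>. \<psi> = (All ^^ n) (separation \<phi>))}
     \<union> {\<psi>. fv \<psi> = {} \<and> (\<exists>n \<phi>. \<psi> = (All ^^ n) (replacement \<phi>))}"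


section \<open>The cumulative hierarchy\<close>

definition transitive_fm :: "nat \<Rightarrow> fm" where
  "transitive_fm x = \<^bold>\<forall>(0 \<^bold>\<in> Suc x \<^bold>\<longrightarrow> subset_fm 0 (Suc x))"

text \<open>In the presence of Foundation, ordinals are the transitive sets of transitive sets.\<close>

definition ord_fm :: "nat \<Rightarrow> fm" where
  "ord_fm x = transitive_fm x \<^bold>\<and> \<^bold>\<forall>(0 \<^bold>\<in> Suc x \<^bold>\<longrightarrow> transitive_fm 0)"

text \<open>The order of the ordinals: \<open>x \<in> y \<or> x = y\<close>.\<close>

definition le_fm :: "nat \<Rightarrow> nat \<Rightarrow> fm" where
  "le_fm x y = x \<^bold>\<in> y \<^bold>\<or> x \<^bold>= y"

text \<open>\<open>z = {x, y}\<close>\<close>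

definition upair_fm :: "nat \<Rightarrow> nat \<Rightarrow> nat \<Rightarrow> fm" where
  "upair_fm z x y = \<^bold>\<forall>(0 \<^bold>\<in> Suc z \<^bold>\<longleftrightarrow> 0 \<^bold>= Suc x \<^bold>\<or> 0 \<^bold>= Suc y)"

text \<open>\<open>p = {{x}, {x, y}}\<close>\<close>

definition pair_fm :: "nat \<Rightarrow> nat \<Rightarrow> nat \<Rightarrow> fm" where
  "pair_fm p x y =
     \<^bold>\<forall>(0 \<^bold>\<in> Suc p \<^bold>\<longleftrightarrow> upair_fm 0 (Suc x) (Suc x) \<^bold>\<or> upair_fm 0 (Suc x) (Suc y))"

text \<open>\<open>(x, y) \<in> f\<close>\<close>

definition app_fm :: "nat \<Rightarrow> nat \<Rightarrow> nat \<Rightarrow> fm" where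
  "app_fm f x y = \<^bold>\<exists>(pair_fm 0 (Suc x) (Suc y) \<^bold>\<and> 0 \<^bold>\<in> Suc f)"

text \<open>\<open>f\<close> is a function with domain \<open>d\<close>.\<close>

definition function_fm :: "nat \<Rightarrow> nat \<Rightarrow> fm" where
  "function_fm f d =
     \<^bold>\<forall>(0 \<^bold>\<in> Suc f \<^bold>\<longrightarrow> \<^bold>\<exists>(0 \<^bold>\<in> (d + 2) \<^bold>\<and> \<^bold>\<exists>(pair_fm 2 1 0))) \<^bold>\<and>
     \<^bold>\<forall>(0 \<^bold>\<in> Suc d \<^bold>\<longrightarrow> \<^bold>\<exists>(\<^bold>\<forall>(app_fm (f + 3) 2 0 \<^bold>\<longleftrightarrow> 0 \<^bold>= 1)))"

text \<open>The recursion \<open>V\<^sub>\<alpha> = (\<Union>\<eta><\<alpha>. Pow V\<^sub>\<eta>)\<close>: \<open>f\<close> is a function with domain \<open>d\<close> and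
  \<open>\<forall>z. z \<in> f(\<alpha>) \<longleftrightarrow> (\<exists>\<eta>\<in>\<alpha>. z \<subseteq> f(\<eta>))\<close> for all \<open>\<alpha> \<in> d\<close>. In the second conjunct the
  bound variables are, from the outside, \<open>\<alpha>\<close>, \<open>v = f(\<alpha>)\<close>, \<open>z\<close>, \<open>\<eta>\<close>, \<open>u = f(\<eta>)\<close>.\<close>

definition hierarchy_fm :: "nat \<Rightarrow> nat \<Rightarrow> fm" where
  "hierarchy_fm f d =
     function_fm f d \<^bold>\<and>
     \<^bold>\<forall>(0 \<^bold>\<in> Suc d \<^bold>\<longrightarrow> \<^bold>\<forall>(app_fm (f + 2) 1 0 \<^bold>\<longrightarrow>
       \<^bold>\<forall>(0 \<^bold>\<in> 1 \<^bold>\<longleftrightarrow> \<^bold>\<exists>(0 \<^bold>\<in> 3 \<^bold>\<and> \<^bold>\<exists>(app_fm (f + 5) 1 0 \<^bold>\<and> subset_fm 2 0)))))"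

text \<open>\<open>v = V\<^sub>b\<close>, the value at \<open>b\<close> of the hierarchy on \<open>b \<union> {b}\<close>\<close>

definition V_fm :: "nat \<Rightarrow> nat \<Rightarrow> fm" where
  "V_fm v b = \<^bold>\<exists>(succ_fm 0 (Suc b) \<^bold>\<and> \<^bold>\<exists>(hierarchy_fm 0 1 \<^bold>\<and> app_fm 0 (b + 2) (v + 2)))"

text \<open>\<open>x \<in> V\<^sub>b\<close>\<close>

definition in_V_fm :: "nat \<Rightarrow> nat \<Rightarrow> fm" where
  "in_V_fm x b = \<^bold>\<exists>(V_fm 0 (Suc b) \<^bold>\<and> Suc x \<^bold>\<in> 0)"

text \<open>\<open>params_in_V k d \<phi>\<close> says that \<open>\<phi>\<close> holds for all values in \<open>V\<^sub>d\<close> of its variables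
  \<open>0, \<dots>, k - 1\<close>; inside \<open>\<phi>\<close> the variable \<open>d\<close> has become \<open>d + k\<close>.\<close>

primrec params_in_V :: "nat \<Rightarrow> nat \<Rightarrow> fm \<Rightarrow> fm" where
  "params_in_V 0 d \<phi> = \<phi>"
| "params_in_V (Suc k) d \<phi> = \<^bold>\<forall>(in_V_fm 0 (Suc d) \<^bold>\<longrightarrow> params_in_V k (Suc d) \<phi>)"


section \<open>Correct cardinals\<close>

inductive Delta0 :: "fm \<Rightarrow> bool" where
  "Delta0 (x \<^bold>\<in> y)"
| "Delta0 (x \<^bold>= y)"
| "Delta0 \<^bold>\<bottom>"
| "Delta0 \<phi> \<Longrightarrow> Delta0 \<psi> \<Longrightarrow> Delta0 (\<phi> \<^bold>\<longrightarrow> \<psi>)"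
| "Delta0 \<phi> \<Longrightarrow> Delta0 (\<^bold>\<forall>(0 \<^bold>\<in> Suc y \<^bold>\<longrightarrow> \<phi>))"
| "Delta0 \<phi> \<Longrightarrow> Delta0 (\<^bold>\<exists>(0 \<^bold>\<in> Suc y \<^bold>\<and> \<phi>))"

text \<open>The Levy hierarchy: at most \<open>n\<close> alternating blocks of unbounded quantifiers in front of a
  \<open>\<Delta>\<^sub>0\<close> formula.\<close>

inductive Levy_Sigma :: "nat \<Rightarrow> fm \<Rightarrow> bool" and Levy_Pi :: "nat \<Rightarrow> fm \<Rightarrow> bool" where
  "Delta0 \<phi> \<Longrightarrow> Levy_Sigma 0 \<phi>"
| "Delta0 \<phi> \<Longrightarrow> Levy_Pi 0 \<phi>"
| "Levy_Pi n \<phi> \<Longrightarrow> Levy_Sigma (Suc n) \<phi>"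
| "Levy_Sigma n \<phi> \<Longrightarrow> Levy_Pi (Suc n) \<phi>"
| "Levy_Sigma (Suc n) \<phi> \<Longrightarrow> Levy_Sigma (Suc n) (\<^bold>\<exists>\<phi>)"
| "Levy_Pi (Suc n) \<phi> \<Longrightarrow> Levy_Pi (Suc n) (\<^bold>\<forall>\<phi>)"

text \<open>\<open>V\<^sub>d \<Turnstile> \<phi>\<close>, as the relativization of \<open>\<phi>\<close> to \<open>V\<^sub>d\<close>\<close>

primrec relativize :: "fm \<Rightarrow> nat \<Rightarrow> fm" where
  "relativize (x \<^bold>\<in> y) d = (x \<^bold>\<in> y)"
| "relativize (x \<^bold>= y) d = (x \<^bold>= y)"
| "relativize \<^bold>\<bottom> d = \<^bold>\<bottom>"
| "relativize (\<phi> \<^bold>\<longrightarrow> \<psi>) d = (relativize \<phi> d \<^bold>\<longrightarrow> relativize \<psi> d)"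
| "relativize (\<^bold>\<forall>\<phi>) d = \<^bold>\<forall>(in_V_fm 0 (Suc d) \<^bold>\<longrightarrow> relativize \<phi> (Suc d))"

text \<open>From here on the ordinal \<open>\<delta>\<close> is the free variable 0.

  \<open>V\<^sub>\<delta> \<prec>\<^bsub>\<Sigma>n\<^esub> V\<close>: the formulas \<open>\<forall>a\<^sub>0 \<dots> a\<^bsub>k-1\<^esub> \<in> V\<^sub>\<delta>. \<phi>(a) \<longleftrightarrow> (V\<^sub>\<delta> \<Turnstile> \<phi>(a))\<close> for \<open>\<phi>\<close> in \<open>\<Sigma>\<^sub>n\<close>.\<close>

definition elementary_scheme :: "nat \<Rightarrow> fm set" where
  "elementary_scheme n =
     {params_in_V k 0 (\<phi> \<^bold>\<longleftrightarrow> relativize \<phi> k) | k \<phi>. Levy_Sigma n \<phi> \<and> fv \<phi> \<subseteq> {..<k}}"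

definition correct_scheme :: "fm set" where
  "correct_scheme = (\<Union>n. elementary_scheme n)"


section \<open>Rank potentialism\<close>

text \<open>The potentialist language: set theory with modal operators.\<close>

datatype mfm = MMem nat nat | MEq nat nat | MFls | MImp mfm mfm | MAll mfm | MBox mfm

abbreviation MDia :: "mfm \<Rightarrow> mfm" where
  "MDia \<phi> \<equiv> MImp (MBox (MImp \<phi> MFls)) MFls"

primrec mfv :: "mfm \<Rightarrow> nat set" where
  "mfv (MMem x y) = {x, y}"
| "mfv (MEq x y) = {x, y}"
| "mfv MFls = {}"
| "mfv (MImp \<phi> \<psi>) = mfv \<phi> \<union> mfv \<psi>"
| "mfv (MAll \<phi>) = {i. Suc i \<in> mfv \<phi>}"
| "mfv (MBox \<phi>) = mfv \<phi>"

text \<open>\<open>true_at \<phi> e w\<close> expresses in the language of set theory that \<open>\<phi>\<close> is true at the world \<open>V\<^sub>w\<close>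
  of rank potentialism, where the free variable \<open>i\<close> of \<open>\<phi>\<close> is represented by the variable \<open>e i\<close>.
  The new variable bound in the modal clause is the index \<open>\<gamma> \<ge> w\<close> of the accessed world.\<close>

primrec true_at :: "mfm \<Rightarrow> (nat \<Rightarrow> nat) \<Rightarrow> nat \<Rightarrow> fm" where
  "true_at (MMem x y) e w = (e x \<^bold>\<in> e y)"
| "true_at (MEq x y) e w = (e x \<^bold>= e y)"
| "true_at MFls e w = \<^bold>\<bottom>"
| "true_at (MImp \<phi> \<psi>) e w = (true_at \<phi> e w \<^bold>\<longrightarrow> true_at \<psi> e w)"
| "true_at (MAll \<phi>) e w =
     \<^bold>\<forall>(in_V_fm 0 (Suc w) \<^bold>\<longrightarrow> true_at \<phi> (case_nat 0 (\<lambda>i. Suc (e i))) (Suc w))"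
| "true_at (MBox \<phi>) e w =
     \<^bold>\<forall>(ord_fm 0 \<^bold>\<and> le_fm (Suc w) 0 \<^bold>\<longrightarrow> true_at \<phi> (\<lambda>i. Suc (e i)) 0)"

text \<open>\<open>\<psi>(a)\<close> is true at \<open>V\<^sub>\<delta>\<close> for all parameters \<open>a\<^sub>0, \<dots>, a\<^bsub>k-1\<^esub> \<in> V\<^sub>\<delta>\<close>.\<close>

definition true_at_V :: "nat \<Rightarrow> mfm \<Rightarrow> fm" where
  "true_at_V k \<psi> = params_in_V k 0 (true_at \<psi> (\<lambda>i. i) k)"


section \<open>Propositional modal logic\<close>

datatype pm = PAtom nat | PFls | PImp pm pm | PBox pm

abbreviation PNeg :: "pm \<Rightarrow> pm" where
  "PNeg p \<equiv> PImp p PFls"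

abbreviation PDia :: "pm \<Rightarrow> pm" where
  "PDia p \<equiv> PNeg (PBox (PNeg p))"

inductive_set S5 :: "pm set" where
  A1: "PImp p (PImp q p) \<in> S5"
| A2: "PImp (PImp p (PImp q r)) (PImp (PImp p q) (PImp p r)) \<in> S5"
| A3: "PImp (PNeg (PNeg p)) p \<in> S5"
| K: "PImp (PBox (PImp p q)) (PImp (PBox p) (PBox q)) \<in> S5"
| T: "PImp (PBox p) p \<in> S5"
| Five: "PImp (PDia p) (PBox (PDia p)) \<in> S5"
| MP: "PImp p q \<in> S5 \<Longrightarrow> p \<in> S5 \<Longrightarrow> q \<in> S5"
| Nec: "p \<in> S5 \<Longrightarrow> PBox p \<in> S5"

primrec psubst :: "(nat \<Rightarrow> mfm) \<Rightarrow> pm \<Rightarrow> mfm" where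
  "psubst \<sigma> (PAtom i) = \<sigma> i"
| "psubst \<sigma> PFls = MFls"
| "psubst \<sigma> (PImp p q) = MImp (psubst \<sigma> p) (psubst \<sigma> q)"
| "psubst \<sigma> (PBox p) = MBox (psubst \<sigma> p)"

text \<open>The assertions that the substitution instances of \<open>p\<close> hold at \<open>V\<^sub>\<delta>\<close> with parameters from
  \<open>V\<^sub>\<delta>\<close>. Together they express that \<open>p\<close> is a potentialist validity at \<open>V\<^sub>\<delta>\<close>.\<close>

definition validity_scheme :: "pm \<Rightarrow> fm set" where
  "validity_scheme p = {true_at_V k (psubst \<sigma> p) | k \<sigma>. mfv (psubst \<sigma> p) \<subseteq> {..<k}}"

definition S5_scheme :: "fm set" where
  "S5_scheme = (\<Union>p\<in>S5. validity_scheme p)"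

definition ZFC_ord :: "fm set" where
  "ZFC_ord = insert (ord_fm 0) ZFC"

end

theory Submission
  imports Defs "HOL-Library.Countable" "HOL-Library.Infinite_Set"
begin

text \<open>By the completeness theorem, derivability from ZFC may be checked in all countable models of
  ZFC. Inside such a model let \<open>\<delta>\<close> be the given ordinal.

  If \<open>V\<^sub>\<delta> \<prec> V\<close>, then a potentialist assertion with parameters in \<open>V\<^sub>\<delta>\<close> that holds at some world
  above \<open>V\<^sub>\<delta>\<close> holds at unboundedly many worlds. So the axiom 5 holds at all worlds above \<open>V\<^sub>\<delta>\<close>, and
  S5 is valid. A modal formula outside S5 fails in a finite universal frame with worlds
  \<open>0, \<dots>, n\<close>, at the world \<open>0\<close> say. The world \<open>V\<^bsub>\<delta>+j\<^esub>\<close> can be recognized from inside as lying \<open>j\<close>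
  steps above a limit, so the distance to the next limit below, capped at \<open>n\<close>, is a dial that
  shows \<open>0\<close> at \<open>V\<^sub>\<delta>\<close> and takes every value at unboundedly many worlds. It carries the valuation of
  the frame to an instance that fails at \<open>V\<^sub>\<delta>\<close>.

  Conversely, replacing \<open>\<forall>\<close> by \<open>\<box>\<forall>\<close> turns truth in \<open>V\<close> into truth at any world. If
  \<open>\<exists>x. \<phi>(x, a)\<close> holds in \<open>V\<close>, then \<open>\<exists>x. \<phi>\<^sup>\<diamond>(x, a)\<close> is possibly necessary at \<open>V\<^sub>\<delta>\<close>, hence true there
  by S5. This is the Tarski--Vaught criterion for \<open>V\<^sub>\<delta> \<prec> V\<close>.\<close>

section \<open>Completeness of the deduction system\<close>

subsection \<open>Renaming and weakening\<close>

lemma rename_cong: "(\<And>i. i \<in> fv \<phi> \<Longrightarrow> r i = r' i) \<Longrightarrow> rename r \<phi> = rename r' \<phi>"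
proof (induction \<phi> arbitrary: r r')
  case (All \<phi>)
  have "rename (case_nat 0 (\<lambda>i. Suc (r i))) \<phi> = rename (case_nat 0 (\<lambda>i. Suc (r' i))) \<phi>"
    using All.prems by (intro All.IH) (auto split: nat.split)
  then show ?case by simp
next
  case (Imp \<phi> \<psi>)
  then show ?case by (metis UnCI fv.simps(4) rename.simps(4))
qed auto

lemma rename_rename: "rename r (rename q \<phi>) = rename (\<lambda>i. r (q i)) \<phi>"
proof (induction \<phi> arbitrary: r q)
  case (All \<phi>)
  have "(\<lambda>i. case_nat 0 (\<lambda>i. Suc (r i)) (case_nat 0 (\<lambda>i. Suc (q i)) i))
      = case_nat 0 (\<lambda>i. Suc (r (q i)))"
    by (auto split: nat.split)
  then show ?case using All by simp
qed auto

lemma rename_ident [simp]: "rename (\<lambda>i. i) \<phi> = \<phi>"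
proof (induction \<phi>)
  case (All \<phi>)
  have "case_nat 0 (\<lambda>i. Suc i) = (\<lambda>i. i)" by (auto split: nat.split)
  then show ?case using All by simp
qed auto

lemma fv_rename: "fv (rename r \<phi>) = r ` fv \<phi>"
proof (induction \<phi> arbitrary: r)
  case (All \<phi>)
  have "Suc i \<in> case_nat 0 (\<lambda>i. Suc (r i)) ` fv \<phi> \<longleftrightarrow> i \<in> r ` {j. Suc j \<in> fv \<phi>}" for i
    by (force split: nat.splits)
  then show ?case using All by auto
qed auto

lemma finite_fv: "finite (fv \<phi>)"
proof (induction \<phi>)
  case (All \<phi>)
  have "fv (\<^bold>\<forall>\<phi>) = Suc -` fv \<phi>" by auto
  then show ?case using All by (simp add: finite_vimageI)
qed auto

lemma fv_bounded: "\<exists>k. fv \<phi> \<subseteq> {..<k}"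
  using finite_fv finite_nat_iff_bounded by blast

lemma rename_inst: "rename r (inst t \<phi>) = inst (r t) (rename (case_nat 0 (\<lambda>i. Suc (r i))) \<phi>)"
  unfolding inst_def rename_rename by (rule rename_cong) (auto split: nat.split)

lemma inst_rename: "inst t (rename (case_nat 0 (\<lambda>i. Suc (r i))) \<phi>) = rename (case_nat t r) \<phi>"
  unfolding inst_def rename_rename by (rule rename_cong) (auto split: nat.split)

lemma deriv_mono: "\<Gamma> \<turnstile> \<phi> \<Longrightarrow> \<Gamma> \<subseteq> \<Delta> \<Longrightarrow> \<Delta> \<turnstile> \<phi>"
proof (induction arbitrary: \<Delta> rule: deriv.induct)
  case (ImpI \<phi> \<Gamma> \<psi>)
  then show ?case by (meson deriv.ImpI insert_mono)
next
  case (Contr \<phi> \<Gamma>)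
  then show ?case by (meson deriv.Contr insert_mono)
next
  case (AllI \<Gamma> \<phi>)
  then show ?case by (meson deriv.AllI image_mono)
qed (blast intro: deriv.intros)+

lemma deriv_rename: "\<Gamma> \<turnstile> \<phi> \<Longrightarrow> rename r ` \<Gamma> \<turnstile> rename r \<phi>"
proof (induction arbitrary: r rule: deriv.induct)
  case (ImpI \<phi> \<Gamma> \<psi>)
  then show ?case by (auto intro: deriv.ImpI)
next
  case (Contr \<phi> \<Gamma>)
  from Contr.IH[of r] show ?case by (auto intro: deriv.Contr)
next
  case (AllI \<Gamma> \<phi>)
  have "rename (case_nat 0 (\<lambda>i. Suc (r i))) ` rename Suc ` \<Gamma> = rename Suc ` rename r ` \<Gamma>"
    by (simp add: image_image rename_rename)
  then show ?case using AllI.IH[of "case_nat 0 (\<lambda>i. Suc (r i))"] by (auto intro: deriv.AllI)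
next
  case (AllE \<Gamma> \<phi> t)
  from AllE.IH[of r] show ?case by (simp add: rename_inst deriv.AllE)
next
  case (EqSubst \<Gamma> x y \<phi>)
  then show ?case by (auto simp: rename_inst intro: deriv.EqSubst)
qed (auto intro: deriv.intros)

lemma mono_insert: "mono F \<Longrightarrow> mono (\<lambda>n. insert x (F n))"
  unfolding mono_def by blast

lemma deriv_UN_mono:
  fixes F :: "nat \<Rightarrow> fm set"
  shows "\<Gamma> \<turnstile> \<phi> \<Longrightarrow> \<Gamma> = (\<Union>n. F n) \<Longrightarrow> mono F \<Longrightarrow> \<exists>n. F n \<turnstile> \<phi>"
proof (induction arbitrary: F rule: deriv.induct)
  case (Assm \<phi> \<Gamma>)
  then show ?case by (blast intro: deriv.Assm)
next
  case (ImpI \<phi> \<Gamma> \<psi>)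
  have "\<exists>n. insert \<phi> (F n) \<turnstile> \<psi>"
    using ImpI.prems by (intro ImpI.IH mono_insert) auto
  then show ?case by (blast intro: deriv.ImpI)
next
  case (ImpE \<Gamma> \<phi> \<psi>)
  then obtain m n where "F m \<turnstile> \<phi> \<^bold>\<longrightarrow> \<psi>" "F n \<turnstile> \<phi>" by blast
  then have "F (max m n) \<turnstile> \<phi> \<^bold>\<longrightarrow> \<psi>" "F (max m n) \<turnstile> \<phi>"
    using deriv_mono monoD[OF ImpE.prems(2)] by (meson max.cobounded1 max.cobounded2)+
  then show ?case by (blast intro: deriv.ImpE)
next
  case (Contr \<phi> \<Gamma>)
  have "\<exists>n. insert (\<^bold>\<not>\<phi>) (F n) \<turnstile> \<^bold>\<bottom>"
    using Contr.prems by (intro Contr.IH mono_insert) auto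
  then show ?case by (blast intro: deriv.Contr)
next
  case (AllI \<Gamma> \<phi>)
  have "mono (\<lambda>n. rename Suc ` F n)" using AllI.prems(2) unfolding mono_def by blast
  then have "\<exists>n. rename Suc ` F n \<turnstile> \<phi>" using AllI.prems(1) by (intro AllI.IH) auto
  then show ?case by (blast intro: deriv.AllI)
next
  case (AllE \<Gamma> \<phi> t)
  then show ?case by (blast intro: deriv.AllE)
next
  case (EqRefl \<Gamma> x)
  then show ?case by (blast intro: deriv.EqRefl)
next
  case (EqSubst \<Gamma> x y \<phi>)
  then obtain m n where "F m \<turnstile> x \<^bold>= y" "F n \<turnstile> inst x \<phi>" by blast
  then have "F (max m n) \<turnstile> x \<^bold>= y" "F (max m n) \<turnstile> inst x \<phi>"
    using deriv_mono monoD[OF EqSubst.prems(2)] by (meson max.cobounded1 max.cobounded2)+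
  then show ?case by (blast intro: deriv.EqSubst)
qed

lemma deriv_All_fresh:
  assumes "\<Gamma> \<turnstile> inst c \<phi>" and fresh: "\<And>\<psi>. \<psi> \<in> \<Gamma> \<Longrightarrow> c \<notin> fv \<psi>" "c \<notin> fv (\<^bold>\<forall>\<phi>)"
  shows "\<Gamma> \<turnstile> \<^bold>\<forall>\<phi>"
proof -
  let ?r = "\<lambda>i. if i = c then 0 else Suc i"
  have "rename ?r ` \<Gamma> = rename Suc ` \<Gamma>"
    using fresh(1) by (intro image_cong refl rename_cong) auto
  moreover have "rename ?r (inst c \<phi>) = rename (\<lambda>i. i) \<phi>"
    unfolding inst_def rename_rename using fresh(2)
    by (intro rename_cong) (auto split: nat.split)
  ultimately have "rename Suc ` \<Gamma> \<turnstile> \<phi>" using deriv_rename[OF assms(1), of ?r] by simp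
  then show ?thesis by (rule deriv.AllI)
qed

subsection \<open>Henkin theories\<close>

definition consistent :: "fm set \<Rightarrow> bool" where
  "consistent \<Gamma> \<longleftrightarrow> \<not> \<Gamma> \<turnstile> \<^bold>\<bottom>"

definition decides_with_witness :: "fm set \<Rightarrow> fm \<Rightarrow> bool" where
  "decides_with_witness \<Gamma> \<chi> \<longleftrightarrow>
     \<chi> \<in> \<Gamma> \<or> \<^bold>\<not>\<chi> \<in> \<Gamma> \<and> (\<forall>\<phi>. \<chi> = \<^bold>\<forall>\<phi> \<longrightarrow> (\<exists>c. \<^bold>\<not>(inst c \<phi>) \<in> \<Gamma>))"

definition unused_variables :: "fm set \<Rightarrow> nat set" where
  "unused_variables \<Gamma> = - (\<Union>\<phi>\<in>\<Gamma>. fv \<phi>)"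

lemma infinite_unused_variables_insert:
  assumes "infinite (unused_variables \<Gamma>)"
  shows "infinite (unused_variables (insert \<phi> \<Gamma>))"
proof -
  have "unused_variables (insert \<phi> \<Gamma>) = unused_variables \<Gamma> - fv \<phi>"
    unfolding unused_variables_def by auto
  then show ?thesis using assms finite_fv by (metis Diff_infinite_finite)
qed

lemma consistent_insert_or_insert_Neg:
  "consistent \<Gamma> \<Longrightarrow> consistent (insert \<phi> \<Gamma>) \<or> consistent (insert (\<^bold>\<not>\<phi>) \<Gamma>)"
  unfolding consistent_def by (meson deriv.Contr deriv.ImpE deriv.ImpI)

lemma consistent_insert_witness:
  assumes "consistent \<Gamma>" and "\<^bold>\<not>\<^bold>\<forall>\<phi> \<in> \<Gamma>" and c: "c \<in> unused_variables \<Gamma>"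
  shows "consistent (insert (\<^bold>\<not>(inst c \<phi>)) \<Gamma>)"
  unfolding consistent_def
proof
  assume "insert (\<^bold>\<not>(inst c \<phi>)) \<Gamma> \<turnstile> \<^bold>\<bottom>"
  then have "\<Gamma> \<turnstile> inst c \<phi>" by (rule deriv.Contr)
  moreover have fresh: "c \<notin> fv \<psi>" if "\<psi> \<in> \<Gamma>" for \<psi>
    using c that unfolding unused_variables_def by blast
  moreover have "c \<notin> fv (\<^bold>\<forall>\<phi>)" using fresh[OF assms(2)] by simp
  ultimately have "\<Gamma> \<turnstile> \<^bold>\<forall>\<phi>" by (rule deriv_All_fresh)
  then show False using assms(1,2) unfolding consistent_def by (meson deriv.Assm deriv.ImpE)
qed

lemma decides_with_witness_extension:
  assumes con: "consistent \<Gamma>" and inf: "infinite (unused_variables \<Gamma>)"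
  shows "\<exists>\<Delta>. \<Gamma> \<subseteq> \<Delta> \<and> consistent \<Delta> \<and> infinite (unused_variables \<Delta>) \<and>
    decides_with_witness \<Delta> \<chi>"
proof -
  define \<Delta> where "\<Delta> = insert (\<^bold>\<not>\<chi>) \<Gamma>"
  have inf_\<Delta>: "infinite (unused_variables \<Delta>)"
    unfolding \<Delta>_def by (rule infinite_unused_variables_insert[OF inf])
  consider (affirm) "consistent (insert \<chi> \<Gamma>)"
    | (deny) "consistent \<Delta>" "\<nexists>\<phi>. \<chi> = \<^bold>\<forall>\<phi>"
    | (deny_All) \<phi> where "consistent \<Delta>" "\<chi> = \<^bold>\<forall>\<phi>"
    using consistent_insert_or_insert_Neg[OF con] unfolding \<Delta>_def by blast
  then show ?thesis
  proof cases
    case affirm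
    then show ?thesis
      using infinite_unused_variables_insert[OF inf, of \<chi>]
      unfolding decides_with_witness_def by blast
  next
    case deny
    then show ?thesis using inf_\<Delta> unfolding decides_with_witness_def \<Delta>_def by blast
  next
    case (deny_All \<phi>)
    obtain c where "c \<in> unused_variables \<Delta>" using inf_\<Delta> infinite_imp_nonempty by blast
    then have "consistent (insert (\<^bold>\<not>(inst c \<phi>)) \<Delta>)"
      using deny_All by (intro consistent_insert_witness) (simp_all add: \<Delta>_def)
    moreover have "decides_with_witness (insert (\<^bold>\<not>(inst c \<phi>)) \<Delta>) \<chi>"
      using deny_All unfolding decides_with_witness_def \<Delta>_def by auto
    moreover have "infinite (unused_variables (insert (\<^bold>\<not>(inst c \<phi>)) \<Delta>))"
      by (rule infinite_unused_variables_insert[OF inf_\<Delta>])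
    ultimately show ?thesis
      by (intro exI[of _ "insert (\<^bold>\<not>(inst c \<phi>)) \<Delta>"]) (auto simp: \<Delta>_def)
  qed
qed

locale henkin_theory =
  fixes T :: "fm set"
  assumes consistent: "consistent T"
    and decides: "decides_with_witness T \<phi>"

instance fm :: countable
  by countable_datatype

lemma henkin_extension:
  assumes "consistent \<Gamma>" "infinite (unused_variables \<Gamma>)"
  obtains T where "henkin_theory T" "\<Gamma> \<subseteq> T"
proof -
  let ?P = "\<lambda>n \<Delta>. consistent \<Delta> \<and> infinite (unused_variables \<Delta>) \<and> (n = 0 \<longrightarrow> \<Gamma> \<subseteq> \<Delta>)"
  let ?Q = "\<lambda>n \<Delta> \<Delta>'. \<Delta> \<subseteq> \<Delta>' \<and> decides_with_witness \<Delta>' (from_nat n)"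
  have "\<exists>F. \<forall>n. ?P n (F n) \<and> ?Q n (F n) (F (Suc n))"
  proof (rule dependent_nat_choice)
    show "\<exists>\<Delta>. ?P 0 \<Delta>" using assms by blast
    show "\<exists>\<Delta>'. ?P (Suc n) \<Delta>' \<and> ?Q n \<Delta> \<Delta>'" if "?P n \<Delta>" for \<Delta> n
      using decides_with_witness_extension[of \<Delta> "from_nat n"] that by auto
  qed
  then obtain F where F: "\<And>n. ?P n (F n)" "\<And>n. ?Q n (F n) (F (Suc n))" by blast
  define T where "T = (\<Union>n. F n)"
  have "mono F" unfolding mono_iff_le_Suc using F(2) by blast
  have "henkin_theory T"
  proof
    show "consistent T"
      using deriv_UN_mono[OF _ T_def \<open>mono F\<close>] F(1) unfolding consistent_def by blast
    show "decides_with_witness T \<phi>" for \<phi>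
      using F(2)[of "to_nat \<phi>"] unfolding T_def decides_with_witness_def by simp blast
  qed
  moreover have "\<Gamma> \<subseteq> T" using F(1)[of 0] unfolding T_def by auto
  ultimately show thesis by (rule that)
qed

subsection \<open>Satisfaction\<close>

primrec sat :: "'a set \<Rightarrow> ('a \<Rightarrow> 'a \<Rightarrow> bool) \<Rightarrow> (nat \<Rightarrow> 'a) \<Rightarrow> fm \<Rightarrow> bool" where
  "sat D E e (x \<^bold>\<in> y) = E (e x) (e y)"
| "sat D E e (x \<^bold>= y) = (e x = e y)"
| "sat D E e \<^bold>\<bottom> = False"
| "sat D E e (\<phi> \<^bold>\<longrightarrow> \<psi>) = (sat D E e \<phi> \<longrightarrow> sat D E e \<psi>)"
| "sat D E e (\<^bold>\<forall>\<phi>) = (\<forall>x\<in>D. sat D E (case_nat x e) \<phi>)"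

text \<open>A biconditional is also an implication, and its meaning should not be unfolded as one.\<close>

declare sat.simps(4) [simp del]

lemma sat_Imp [simp]:
  "NO_MATCH (\<phi>' \<^bold>\<longleftrightarrow> \<psi>') (\<phi> \<^bold>\<longrightarrow> \<psi>) \<Longrightarrow> sat D E e (\<phi> \<^bold>\<longrightarrow> \<psi>) \<longleftrightarrow> (sat D E e \<phi> \<longrightarrow> sat D E e \<psi>)"
  by (rule sat.simps(4))

lemma sat_Dis [simp]: "sat D E e (\<phi> \<^bold>\<or> \<psi>) \<longleftrightarrow> sat D E e \<phi> \<or> sat D E e \<psi>"
  by auto

lemma sat_Iff [simp]: "sat D E e (\<phi> \<^bold>\<longleftrightarrow> \<psi>) \<longleftrightarrow> (sat D E e \<phi> \<longleftrightarrow> sat D E e \<psi>)"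
  by (auto simp: sat.simps(4))

lemma sat_cong: "(\<And>i. i \<in> fv \<phi> \<Longrightarrow> e i = e' i) \<Longrightarrow> sat D E e \<phi> = sat D E e' \<phi>"
proof (induction \<phi> arbitrary: e e')
  case (Imp \<phi> \<psi>)
  then show ?case by (metis UnCI fv.simps(4) sat.simps(4))
next
  case (All \<phi>)
  have "sat D E (case_nat x e) \<phi> = sat D E (case_nat x e') \<phi>" for x
    using All.prems by (intro All.IH) (auto split: nat.split)
  then show ?case by simp
qed auto

lemma sat_rename: "sat D E e (rename r \<phi>) = sat D E (\<lambda>i. e (r i)) \<phi>"
proof (induction \<phi> arbitrary: e r)
  case (All \<phi>)
  have "(\<lambda>i. case_nat x e (case_nat 0 (\<lambda>i. Suc (r i)) i)) = case_nat x (\<lambda>i. e (r i))" for x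
    by (auto split: nat.split)
  then show ?case using All by simp
qed auto

lemma sat_iso:
  assumes "bij_betw g A D"
  shows "range e \<subseteq> A \<Longrightarrow> sat A (\<lambda>x y. E (g x) (g y)) e \<phi> = sat D E (\<lambda>i. g (e i)) \<phi>"
proof (induction \<phi> arbitrary: e)
  case (Eq x y)
  then show ?case using assms by (auto simp: bij_betw_def inj_on_eq_iff image_subset_iff)
next
  case (All \<phi>)
  have "(\<lambda>i. g (case_nat x e i)) = case_nat (g x) (\<lambda>i. g (e i))" for x
    by (auto split: nat.split)
  moreover have "range (case_nat x e) \<subseteq> A" if "x \<in> A" for x
    using that All.prems by (auto split: nat.split simp: image_subset_iff)
  ultimately have "sat A (\<lambda>x y. E (g x) (g y)) (case_nat x e) \<phi>
      = sat D E (case_nat (g x) (\<lambda>i. g (e i))) \<phi>" if "x \<in> A" for x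
    using that All.IH by simp
  moreover have "D = g ` A" using assms by (simp add: bij_betw_def)
  ultimately show ?case by simp
qed auto

subsection \<open>The term model\<close>

context henkin_theory
begin

lemma Neg_mem_iff: "\<^bold>\<not>\<phi> \<in> T \<longleftrightarrow> \<phi> \<notin> T"
  using consistent decides[of \<phi>] unfolding consistent_def decides_with_witness_def
  by (meson deriv.Assm deriv.ImpE)

lemma mem_if_deriv: "T \<turnstile> \<phi> \<Longrightarrow> \<phi> \<in> T"
  using consistent Neg_mem_iff unfolding consistent_def by (meson deriv.Assm deriv.ImpE)

lemma Imp_mem_iff: "(\<phi> \<^bold>\<longrightarrow> \<psi>) \<in> T \<longleftrightarrow> (\<phi> \<in> T \<longrightarrow> \<psi> \<in> T)"
proof
  assume "(\<phi> \<^bold>\<longrightarrow> \<psi>) \<in> T"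
  then show "\<phi> \<in> T \<longrightarrow> \<psi> \<in> T" by (meson mem_if_deriv deriv.Assm deriv.ImpE)
next
  assume "\<phi> \<in> T \<longrightarrow> \<psi> \<in> T"
  then consider (conclusion) "\<psi> \<in> T" | (premise) "\<^bold>\<not>\<phi> \<in> T" using Neg_mem_iff by blast
  then have "insert \<phi> T \<turnstile> \<psi>"
  proof cases
    case premise
    then have "insert (\<^bold>\<not>\<psi>) (insert \<phi> T) \<turnstile> \<^bold>\<bottom>" by (meson deriv.Assm deriv.ImpE insertI1 insertI2)
    then show ?thesis by (rule deriv.Contr)
  qed (blast intro: deriv.Assm)
  then show "(\<phi> \<^bold>\<longrightarrow> \<psi>) \<in> T" by (intro mem_if_deriv deriv.ImpI)
qed

lemma All_mem_iff: "\<^bold>\<forall>\<phi> \<in> T \<longleftrightarrow> (\<forall>t. inst t \<phi> \<in> T)"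
proof
  assume "\<^bold>\<forall>\<phi> \<in> T"
  then show "\<forall>t. inst t \<phi> \<in> T" by (blast intro: mem_if_deriv deriv.AllE deriv.Assm)
next
  assume "\<forall>t. inst t \<phi> \<in> T"
  then show "\<^bold>\<forall>\<phi> \<in> T"
    using decides[of "\<^bold>\<forall>\<phi>"] Neg_mem_iff unfolding decides_with_witness_def by blast
qed

lemma inst_mem_cong: "(x \<^bold>= y) \<in> T \<Longrightarrow> inst x \<phi> \<in> T \<Longrightarrow> inst y \<phi> \<in> T"
  by (meson mem_if_deriv deriv.Assm deriv.EqSubst)

lemma Eq_mem_refl: "(x \<^bold>= x) \<in> T"
  by (simp add: mem_if_deriv deriv.EqRefl)

lemma Eq_mem_sym: "(x \<^bold>= y) \<in> T \<Longrightarrow> (y \<^bold>= x) \<in> T"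
  using inst_mem_cong[of x y "0 \<^bold>= Suc x"] Eq_mem_refl by (simp add: inst_def)

lemma Eq_mem_trans: "(x \<^bold>= y) \<in> T \<Longrightarrow> (y \<^bold>= z) \<in> T \<Longrightarrow> (x \<^bold>= z) \<in> T"
  using inst_mem_cong[of y z "Suc x \<^bold>= 0"] by (simp add: inst_def)

lemma Mem_mem_cong:
  assumes "(x \<^bold>= x') \<in> T" "(y \<^bold>= y') \<in> T" "(x \<^bold>\<in> y) \<in> T"
  shows "(x' \<^bold>\<in> y') \<in> T"
proof -
  have "(x' \<^bold>\<in> y) \<in> T" using inst_mem_cong[of x x' "0 \<^bold>\<in> Suc y"] assms by (simp add: inst_def)
  then show ?thesis using inst_mem_cong[of y y' "Suc x' \<^bold>\<in> 0"] assms by (simp add: inst_def)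
qed

definition representative :: "nat \<Rightarrow> nat" where
  "representative x = (LEAST y. (x \<^bold>= y) \<in> T)"

lemma Eq_mem_representative: "(x \<^bold>= representative x) \<in> T"
  unfolding representative_def using Eq_mem_refl by (rule LeastI)

lemma representative_eq_iff: "representative x = representative y \<longleftrightarrow> (x \<^bold>= y) \<in> T"
proof
  assume "representative x = representative y"
  then show "(x \<^bold>= y) \<in> T" by (metis Eq_mem_representative Eq_mem_sym Eq_mem_trans)
next
  assume "(x \<^bold>= y) \<in> T"
  then have "(x \<^bold>= z) \<in> T \<longleftrightarrow> (y \<^bold>= z) \<in> T" for z using Eq_mem_sym Eq_mem_trans by blast
  then show "representative x = representative y" unfolding representative_def by simp
qed

lemma Mem_representative_iff: "(representative x \<^bold>\<in> representative y) \<in> T \<longleftrightarrow> (x \<^bold>\<in> y) \<in> T"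
  using Mem_mem_cong Eq_mem_representative Eq_mem_sym by blast

lemma sat_term_model_iff:
  "sat (range representative) (\<lambda>a b. (a \<^bold>\<in> b) \<in> T) (\<lambda>i. representative (r i)) \<phi> \<longleftrightarrow> rename r \<phi> \<in> T"
proof (induction \<phi> arbitrary: r)
  case Fls
  then show ?case using consistent unfolding consistent_def by (auto intro: deriv.Assm)
next
  case (All \<phi>)
  have "case_nat (representative t) (\<lambda>i. representative (r i)) =
      (\<lambda>i. representative (case_nat t r i))" for t
    by (rule ext) (simp split: nat.split)
  then show ?case by (simp add: All_mem_iff inst_rename All.IH)
qed (auto simp: Imp_mem_iff Mem_representative_iff representative_eq_iff)

end

theorem completeness:
  assumes valid: "\<And>(D :: nat set) E e. range e \<subseteq> D \<Longrightarrow> \<forall>\<psi>\<in>\<Gamma>. sat D E e \<psi> \<Longrightarrow> sat D E e \<phi>"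
  shows "\<Gamma> \<turnstile> \<phi>"
proof (rule ccontr)
  assume not: "\<not> \<Gamma> \<turnstile> \<phi>"
  \<comment> \<open>Doubling all indices frees infinitely many variables for use as Henkin witnesses.\<close>
  define \<Delta> where "\<Delta> = rename (\<lambda>i. 2 * i) ` insert (\<^bold>\<not>\<phi>) \<Gamma>"
  have "rename (\<lambda>i. i div 2) ` \<Delta> = insert (\<^bold>\<not>\<phi>) \<Gamma>"
    unfolding \<Delta>_def by (simp add: image_image rename_rename)
  then have "consistent \<Delta>"
    using not deriv_rename[of \<Delta> "\<^bold>\<bottom>" "\<lambda>i. i div 2"] unfolding consistent_def
    by (auto intro: deriv.Contr)
  moreover have "infinite (unused_variables \<Delta>)"
  proof (rule infinite_super)
    show "range (\<lambda>i. 2 * i + 1) \<subseteq> unused_variables \<Delta>"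
      unfolding unused_variables_def \<Delta>_def by (auto simp: fv_rename) presburger+
    show "infinite (range (\<lambda>i::nat. 2 * i + 1))" by (intro range_inj_infinite injI) simp
  qed
  ultimately obtain T where "henkin_theory T" "\<Delta> \<subseteq> T" by (rule henkin_extension)
  interpret henkin_theory T by fact
  let ?sat = "sat (range representative) (\<lambda>a b. (a \<^bold>\<in> b) \<in> T) (\<lambda>i. representative (2 * i))"
  have "?sat \<psi>" if "\<psi> \<in> insert (\<^bold>\<not>\<phi>) \<Gamma>" for \<psi>
    using that \<open>\<Delta> \<subseteq> T\<close> unfolding sat_term_model_iff \<Delta>_def by blast
  from this[of "\<^bold>\<not>\<phi>"] this have "\<not> ?sat \<phi>" "\<forall>\<psi>\<in>\<Gamma>. ?sat \<psi>" by simp_all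
  moreover have "range (\<lambda>i. representative (2 * i)) \<subseteq> range representative" by auto
  ultimately show False using valid by blast
qed

corollary completeness_infinite_models:
  assumes infinite: "\<And>(D :: nat set) E e. range e \<subseteq> D \<Longrightarrow> \<forall>\<psi>\<in>\<Gamma>. sat D E e \<psi> \<Longrightarrow> infinite D"
    and valid: "\<And>(E :: nat \<Rightarrow> nat \<Rightarrow> bool) e. \<forall>\<psi>\<in>\<Gamma>. sat UNIV E e \<psi> \<Longrightarrow> sat UNIV E e \<phi>"
  shows "\<Gamma> \<turnstile> \<phi>"
proof (rule completeness)
  fix D :: "nat set" and E e
  assume e: "range e \<subseteq> D" and \<Gamma>: "\<forall>\<psi>\<in>\<Gamma>. sat D E e \<psi>"
  define g where "g = enumerate D"
  have g: "bij_betw g UNIV D" unfolding g_def using bij_enumerate infinite[OF e \<Gamma>] .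
  define d where "d = (\<lambda>i. inv_into UNIV g (e i))"
  have "(\<lambda>i. g (d i)) = e"
    using g e unfolding d_def by (auto simp: bij_betw_def f_inv_into_f image_subset_iff)
  then have "sat UNIV (\<lambda>x y. E (g x) (g y)) d \<psi> \<longleftrightarrow> sat D E e \<psi>" for \<psi>
    using sat_iso[OF g, of d E \<psi>] by simp
  then show "sat D E e \<phi>" using valid \<Gamma> by blast
qed

section \<open>Completeness of S5 for finite universal frames\<close>

subsection \<open>Maximal consistent sets\<close>

inductive S5_deriv :: "pm set \<Rightarrow> pm \<Rightarrow> bool" for \<Gamma> where
  hyp: "p \<in> \<Gamma> \<Longrightarrow> S5_deriv \<Gamma> p"
| axm: "p \<in> S5 \<Longrightarrow> S5_deriv \<Gamma> p"
| detach: "S5_deriv \<Gamma> (PImp p q) \<Longrightarrow> S5_deriv \<Gamma> p \<Longrightarrow> S5_deriv \<Gamma> q"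

lemma S5_deriv_mono: "S5_deriv \<Gamma> p \<Longrightarrow> \<Gamma> \<subseteq> \<Delta> \<Longrightarrow> S5_deriv \<Delta> p"
  by (induction rule: S5_deriv.induct) (auto intro: S5_deriv.intros)

lemma S5_if_S5_deriv_empty: "S5_deriv {} p \<Longrightarrow> p \<in> S5"
  by (induction rule: S5_deriv.induct) (auto intro: S5.MP)

lemma S5_deriv_double_negation: "S5_deriv \<Gamma> (PNeg (PNeg p)) \<Longrightarrow> S5_deriv \<Gamma> p"
  by (meson S5.A3 S5_deriv.axm S5_deriv.detach)

lemma S5_deriv_PImpI: "S5_deriv (insert p \<Gamma>) q \<Longrightarrow> S5_deriv \<Gamma> (PImp p q)"
proof (induction rule: S5_deriv.induct)
  case (hyp q)
  have "PImp p p \<in> S5" by (meson S5.A1 S5.A2 S5.MP)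
  then show ?case using hyp by (metis S5.A1 S5_deriv.simps insertE)
next
  case (axm q)
  then show ?case by (meson S5.A1 S5.MP S5_deriv.axm)
next
  case (detach q r)
  then show ?case by (meson S5.A2 S5_deriv.detach S5_deriv.axm)
qed

lemma S5_deriv_finite: "S5_deriv \<Gamma> p \<Longrightarrow> \<exists>\<Delta>\<subseteq>\<Gamma>. finite \<Delta> \<and> S5_deriv \<Delta> p"
proof (induction rule: S5_deriv.induct)
  case (hyp p)
  then show ?case by (intro exI[of _ "{p}"]) (auto intro: S5_deriv.hyp)
next
  case (axm p)
  then show ?case by (intro exI[of _ "{}"]) (auto intro: S5_deriv.axm)
next
  case (detach p q)
  then obtain \<Delta> \<Delta>' where "\<Delta> \<subseteq> \<Gamma>" "finite \<Delta>" "S5_deriv \<Delta> (PImp p q)"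
    "\<Delta>' \<subseteq> \<Gamma>" "finite \<Delta>'" "S5_deriv \<Delta>' p"
    by blast
  then show ?case
    by (intro exI[of _ "\<Delta> \<union> \<Delta>'"])
      (auto intro: S5_deriv.detach S5_deriv_mono[of \<Delta>] S5_deriv_mono[of \<Delta>'])
qed

lemma S5_deriv_PBox: "S5_deriv \<Gamma> p \<Longrightarrow> S5_deriv (PBox ` \<Gamma>) (PBox p)"
proof (induction rule: S5_deriv.induct)
  case (detach p q)
  then show ?case by (meson S5.K S5_deriv.detach S5_deriv.axm)
qed (auto intro: S5_deriv.intros S5.Nec)

definition mcs :: "pm set \<Rightarrow> bool" where
  "mcs w \<longleftrightarrow> \<not> S5_deriv w PFls \<and> (\<forall>p. p \<notin> w \<longrightarrow> S5_deriv (insert p w) PFls)"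

lemma mcs_extension:
  assumes "\<not> S5_deriv \<Gamma> PFls"
  obtains w where "mcs w" "\<Gamma> \<subseteq> w"
proof -
  let ?A = "{\<Delta>. \<Gamma> \<subseteq> \<Delta> \<and> \<not> S5_deriv \<Delta> PFls}"
  have "\<exists>w\<in>?A. \<forall>\<Delta>\<in>?A. w \<subseteq> \<Delta> \<longrightarrow> \<Delta> = w"
  proof (rule subset_Zorn_nonempty)
    show "?A \<noteq> {}" using assms by auto
  next
    fix C assume C: "C \<noteq> {}" "subset.chain ?A C"
    have "\<not> S5_deriv (\<Union>C) PFls"
    proof
      assume "S5_deriv (\<Union>C) PFls"
      then obtain \<Delta> where \<Delta>: "\<Delta> \<subseteq> \<Union>C" "finite \<Delta>" "S5_deriv \<Delta> PFls"
        using S5_deriv_finite by blast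
      then obtain X where "X \<in> C" "\<Delta> \<subseteq> X"
        using finite_subset_Union_chain[OF \<Delta>(2,1) C] by blast
      moreover from this have "\<not> S5_deriv X PFls" using C(2) by (auto simp: subset.chain_def)
      ultimately show False using S5_deriv_mono[OF \<Delta>(3)] by simp
    qed
    then show "\<Union>C \<in> ?A" using C unfolding subset.chain_def by blast
  qed
  then obtain w where w: "w \<in> ?A" and max: "\<forall>\<Delta>\<in>?A. w \<subseteq> \<Delta> \<longrightarrow> \<Delta> = w" by (rule bexE)
  have "S5_deriv (insert p w) PFls" if "p \<notin> w" for p
  proof (rule ccontr)
    assume "\<not> S5_deriv (insert p w) PFls"
    then have "insert p w \<in> ?A" using w by auto
    then show False using max that by (metis insertI1 subset_insertI)
  qed
  then have "mcs w" using w unfolding mcs_def by simp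
  then show thesis using that w by simp
qed

lemma mcs_closed: "mcs w \<Longrightarrow> S5_deriv w p \<Longrightarrow> p \<in> w"
  unfolding mcs_def by (meson S5_deriv_PImpI S5_deriv.detach)

lemma mcs_S5: "mcs w \<Longrightarrow> p \<in> S5 \<Longrightarrow> p \<in> w"
  by (simp add: S5_deriv.axm mcs_closed)

lemma mcs_PFls: "mcs w \<Longrightarrow> PFls \<notin> w"
  unfolding mcs_def by (auto intro: S5_deriv.hyp)

lemma mcs_PImp_iff:
  assumes w: "mcs w"
  shows "PImp p q \<in> w \<longleftrightarrow> (p \<in> w \<longrightarrow> q \<in> w)"
proof
  assume "PImp p q \<in> w"
  then show "p \<in> w \<longrightarrow> q \<in> w" using w by (meson S5_deriv.hyp S5_deriv.detach mcs_closed)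
next
  assume "p \<in> w \<longrightarrow> q \<in> w"
  then consider (conclusion) "q \<in> w" | (premise) "S5_deriv (insert p w) PFls"
    using w unfolding mcs_def by blast
  then have "S5_deriv (insert p w) q"
  proof cases
    case conclusion
    then show ?thesis by (simp add: S5_deriv.hyp)
  next
    case premise
    then have "S5_deriv (insert p w) (PNeg (PNeg q))" by (meson S5.A1 S5_deriv.detach S5_deriv.axm)
    then show ?thesis by (rule S5_deriv_double_negation)
  qed
  then show "PImp p q \<in> w" by (intro mcs_closed[OF w] S5_deriv_PImpI)
qed

lemmas mcs_simps = mcs_PFls mcs_PImp_iff

lemma S5_if_in_all_mcs:
  assumes all: "\<And>w. mcs w \<Longrightarrow> p \<in> w"
  shows "p \<in> S5"
proof (rule ccontr)
  assume "p \<notin> S5"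
  then have "\<not> S5_deriv {PNeg p} PFls"
    using S5_deriv_PImpI S5_deriv_double_negation S5_if_S5_deriv_empty by blast
  then obtain w where "mcs w" "PNeg p \<in> w" using mcs_extension by blast
  then show False using all by (auto simp: mcs_simps)
qed

lemma mcs_PBox_mono:
  assumes "mcs w" "PBox p \<in> w" and le: "\<And>v. mcs v \<Longrightarrow> p \<in> v \<Longrightarrow> q \<in> v"
  shows "PBox q \<in> w"
proof -
  have "PImp p q \<in> S5" using le by (intro S5_if_in_all_mcs) (auto simp: mcs_simps)
  then have "PImp (PBox p) (PBox q) \<in> S5" by (meson S5.K S5.MP S5.Nec)
  then show ?thesis using assms(1,2) mcs_S5 mcs_PImp_iff by blast
qed

lemma mcs_T: "mcs w \<Longrightarrow> PBox p \<in> w \<Longrightarrow> p \<in> w"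
  using mcs_S5[OF _ S5.T] mcs_PImp_iff by blast

lemma mcs_PBox_PNeg_PBox:
  assumes w: "mcs w" and "PBox p \<notin> w"
  shows "PBox (PNeg (PBox p)) \<in> w"
proof -
  have PBox_cong: "PBox (PNeg (PNeg p)) \<in> v \<longleftrightarrow> PBox p \<in> v" if "mcs v" for v
    using mcs_PBox_mono[OF that, of p "PNeg (PNeg p)"] mcs_PBox_mono[OF that, of "PNeg (PNeg p)" p]
    by (auto simp: mcs_simps)
  then have "PDia (PNeg p) \<in> w" using assms by (simp add: mcs_simps)
  then have "PBox (PDia (PNeg p)) \<in> w" using mcs_S5[OF w S5.Five] mcs_PImp_iff[OF w] by blast
  then show ?thesis by (rule mcs_PBox_mono[OF w]) (simp add: mcs_simps PBox_cong)
qed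

lemma mcs_4:
  assumes w: "mcs w" and "PBox p \<in> w"
  shows "PBox (PBox p) \<in> w"
proof -
  have "PNeg (PBox p) \<notin> w" using assms by (simp add: mcs_simps)
  then have "PBox (PNeg (PBox (PNeg (PBox p)))) \<in> w"
    using mcs_PBox_PNeg_PBox[OF w] mcs_T[OF w] by blast
  then show ?thesis
    by (rule mcs_PBox_mono[OF w]) (metis mcs_PBox_PNeg_PBox mcs_PFls mcs_PImp_iff)
qed

lemma S5_PDia_PBox: "PImp (PDia (PBox p)) p \<in> S5"
proof (rule S5_if_in_all_mcs)
  fix w assume w: "mcs w"
  then show "PImp (PDia (PBox p)) p \<in> w"
    using mcs_PBox_PNeg_PBox[OF w, of p] mcs_T[OF w] by (auto simp: mcs_simps)
qed

subsection \<open>The canonical frame\<close>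

primrec atoms :: "pm \<Rightarrow> nat set" where
  "atoms (PAtom i) = {i}"
| "atoms PFls = {}"
| "atoms (PImp p q) = atoms p \<union> atoms q"
| "atoms (PBox p) = atoms p"

lemma finite_atoms: "finite (atoms p)"
  by (induction p) auto

text \<open>In a universal frame a world matters only through the set of atoms that it makes true.\<close>

primrec holds :: "nat set set \<Rightarrow> nat set \<Rightarrow> pm \<Rightarrow> bool" where
  "holds W v (PAtom i) = (i \<in> v)"
| "holds W v PFls = False"
| "holds W v (PImp p q) = (holds W v p \<longrightarrow> holds W v q)"
| "holds W v (PBox p) = (\<forall>u\<in>W. holds W u p)"

definition cluster :: "pm set \<Rightarrow> pm set set" where
  "cluster w = {u. mcs u \<and> (\<forall>q. PBox q \<in> u \<longleftrightarrow> PBox q \<in> w)}"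

lemma cluster_witness:
  assumes w: "mcs w" and q: "PBox q \<notin> w"
  obtains u where "u \<in> cluster w" "q \<notin> u"
proof -
  define B where "B = {r. PBox r \<in> w \<and> (r \<in> range PBox \<or> r \<in> range (\<lambda>s. PNeg (PBox s)))}"
  have "\<not> S5_deriv (insert (PNeg q) B) PFls"
  proof
    assume "S5_deriv (insert (PNeg q) B) PFls"
    then have "S5_deriv B q" using S5_deriv_PImpI S5_deriv_double_negation by blast
    then have "S5_deriv (PBox ` B) (PBox q)" by (rule S5_deriv_PBox)
    then have "S5_deriv w (PBox q)" by (rule S5_deriv_mono) (auto simp: B_def)
    then show False using q w mcs_closed by blast
  qed
  then obtain u where u: "mcs u" "insert (PNeg q) B \<subseteq> u" using mcs_extension by blast
  have "PBox r \<in> u \<longleftrightarrow> PBox r \<in> w" for r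
  proof (cases "PBox r \<in> w")
    case True
    then have "PBox r \<in> B" using mcs_4[OF w] unfolding B_def by blast
    then show ?thesis using True u by auto
  next
    case False
    then have "PNeg (PBox r) \<in> B" using mcs_PBox_PNeg_PBox[OF w] unfolding B_def by blast
    then have "PNeg (PBox r) \<in> u" using u by auto
    then show ?thesis using False u by (auto simp: mcs_simps)
  qed
  then show thesis using u by (intro that[of u]) (auto simp: cluster_def mcs_simps)
qed

definition true_atoms :: "nat set \<Rightarrow> pm set \<Rightarrow> nat set" where
  "true_atoms A u = {i \<in> A. PAtom i \<in> u}"

lemma holds_cluster_iff:
  assumes w: "mcs w"
  shows "u \<in> cluster w \<Longrightarrow> atoms q \<subseteq> A \<Longrightarrow>
    holds (true_atoms A ` cluster w) (true_atoms A u) q \<longleftrightarrow> q \<in> u"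
proof (induction q arbitrary: u)
  case (PBox q)
  have "(\<forall>u\<in>cluster w. q \<in> u) \<longleftrightarrow> PBox q \<in> w"
  proof
    assume "\<forall>u\<in>cluster w. q \<in> u"
    then show "PBox q \<in> w" using cluster_witness[OF w] by metis
  next
    assume "PBox q \<in> w"
    then show "\<forall>u\<in>cluster w. q \<in> u" using mcs_T unfolding cluster_def by blast
  qed
  then show ?case using PBox unfolding cluster_def by auto
qed (auto simp: true_atoms_def cluster_def mcs_simps)

theorem S5_finite_model:
  assumes "p \<notin> S5"
  obtains W v where "finite W" "v \<in> W" "\<not> holds W v p"
proof -
  obtain w where w: "mcs w" "p \<notin> w" using S5_if_in_all_mcs assms by blast
  let ?val = "true_atoms (atoms p)"
  have "?val ` cluster w \<subseteq> Pow (atoms p)" unfolding true_atoms_def by auto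
  then have "finite (?val ` cluster w)" using finite_atoms finite_subset by blast
  moreover have "w \<in> cluster w" using w(1) unfolding cluster_def by blast
  moreover from this have "\<not> holds (?val ` cluster w) (?val w) p"
    using w holds_cluster_iff by simp
  ultimately show thesis using that by blast
qed

section \<open>Models of ZFC\<close>

subsection \<open>The meaning of the axioms\<close>

lemma sat_subset_fm:
  "sat D E e (subset_fm x y) \<longleftrightarrow> (\<forall>z\<in>D. E z (e x) \<longrightarrow> E z (e y))"
  by (simp add: subset_fm_def)

lemma sat_extensionality:
  "sat D E e extensionality \<longleftrightarrow> (\<forall>x\<in>D. \<forall>y\<in>D. (\<forall>z\<in>D. E z x \<longleftrightarrow> E z y) \<longrightarrow> x = y)"
  by (simp add: extensionality_def eval_nat_numeral)

lemma sat_foundation: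
  "sat D E e foundation \<longleftrightarrow>
     (\<forall>x\<in>D. (\<exists>y\<in>D. E y x) \<longrightarrow> (\<exists>y\<in>D. E y x \<and> \<not> (\<exists>z\<in>D. E z y \<and> E z x)))"
  by (auto simp: foundation_def eval_nat_numeral)

lemma sat_pairing:
  "sat D E e pairing \<longleftrightarrow> (\<forall>x\<in>D. \<forall>y\<in>D. \<exists>p\<in>D. \<forall>z\<in>D. E z p \<longleftrightarrow> z = x \<or> z = y)"
  by (simp add: pairing_def eval_nat_numeral)

lemma sat_union_ax:
  "sat D E e union_ax \<longleftrightarrow> (\<forall>x\<in>D. \<exists>u\<in>D. \<forall>z\<in>D. E z u \<longleftrightarrow> (\<exists>y\<in>D. E y x \<and> E z y))"
  by (simp add: union_ax_def eval_nat_numeral)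

lemma sat_powerset:
  "sat D E e powerset \<longleftrightarrow> (\<forall>x\<in>D. \<exists>p\<in>D. \<forall>z\<in>D. E z p \<longleftrightarrow> (\<forall>w\<in>D. E w z \<longrightarrow> E w x))"
  by (simp add: powerset_def sat_subset_fm eval_nat_numeral)

lemma sat_succ_fm:
  "sat D E e (succ_fm s x) \<longleftrightarrow> (\<forall>z\<in>D. E z (e s) \<longleftrightarrow> E z (e x) \<or> z = e x)"
  by (simp add: succ_fm_def)

lemma sat_infinity:
  "sat D E e infinity \<longleftrightarrow> (\<exists>i\<in>D. (\<exists>z\<in>D. E z i \<and> \<not> (\<exists>y\<in>D. E y z)) \<and>
     (\<forall>x\<in>D. E x i \<longrightarrow> (\<exists>s\<in>D. E s i \<and> (\<forall>z\<in>D. E z s \<longleftrightarrow> E z x \<or> z = x))))"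
  by (simp add: infinity_def sat_succ_fm eval_nat_numeral)

lemma fv_ZFC: "\<phi> \<in> ZFC \<Longrightarrow> fv \<phi> = {}"
  by (auto simp: ZFC_def extensionality_def foundation_def pairing_def union_ax_def powerset_def
      infinity_def choice_def subset_fm_def succ_fm_def eval_nat_numeral)

lemma fv_funpow_All: "fv ((All ^^ n) \<phi>) = {i. i + n \<in> fv \<phi>}"
  by (induction n) auto

lemma ZFC_model_no_universal_set:
  assumes ZFC: "\<forall>\<phi>\<in>ZFC. sat D E e \<phi>" and u: "u \<in> D"
  shows "\<exists>x\<in>D. \<not> E x u"
proof
  have "sat D E e pairing" "sat D E e foundation" using ZFC by (simp_all add: ZFC_def)
  note pairing = this(1)[unfolded sat_pairing] and foundation = this(2)[unfolded sat_foundation]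
  obtain s where s: "s \<in> D" "\<forall>z\<in>D. E z s \<longleftrightarrow> z = u" using pairing u by metis
  then have "\<exists>y\<in>D. E y s" using u by blast
  then obtain y where "y \<in> D" "E y s" "\<not> (\<exists>z\<in>D. E z y \<and> E z s)"
    using bspec[OF foundation s(1)] by blast
  then show "\<not> E u u" using s u by metis
  show "u \<in> D" by (fact u)
qed

lemma ZFC_model_finite_bounded:
  assumes ZFC: "\<forall>\<phi>\<in>ZFC. sat D E e \<phi>" and "D \<noteq> {}"
  shows "finite F \<Longrightarrow> F \<subseteq> D \<Longrightarrow> \<exists>u\<in>D. \<forall>z\<in>F. E z u"
proof (induction F rule: finite_induct)
  case empty
  then show ?case using \<open>D \<noteq> {}\<close> by auto
next
  case (insert a F)
  have "sat D E e pairing" "sat D E e union_ax" using ZFC by (simp_all add: ZFC_def)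
  note pairing = this(1)[unfolded sat_pairing] and union = this(2)[unfolded sat_union_ax]
  obtain u where u: "u \<in> D" "\<forall>z\<in>F. E z u" using insert by auto
  have "a \<in> D" using insert.prems by simp
  then obtain b where b: "b \<in> D" "\<forall>z\<in>D. E z b \<longleftrightarrow> z = a" using pairing by metis
  then obtain p where p: "p \<in> D" "\<forall>z\<in>D. E z p \<longleftrightarrow> z = u \<or> z = b" using pairing u(1) by metis
  then obtain v where v: "v \<in> D" "\<forall>z\<in>D. E z v \<longleftrightarrow> (\<exists>y\<in>D. E y p \<and> E z y)" using union by blast
  then have "\<forall>z\<in>insert a F. E z v" using insert.prems u b p by blast
  then show ?case using v(1) by blast
qed

lemma ZFC_model_infinite:
  assumes "\<forall>\<phi>\<in>ZFC. sat D E e \<phi>" "D \<noteq> {}"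
  shows "infinite D"
  using ZFC_model_finite_bounded[OF assms, of D] ZFC_model_no_universal_set[OF assms(1)] by blast

theorem ZFC_completeness:
  assumes "ZFC \<subseteq> \<Gamma>"
    and "\<And>(E :: nat \<Rightarrow> nat \<Rightarrow> bool) e. \<forall>\<psi>\<in>\<Gamma>. sat UNIV E e \<psi> \<Longrightarrow> sat UNIV E e \<phi>"
  shows "\<Gamma> \<turnstile> \<phi>"
proof (rule completeness_infinite_models)
  show "infinite D" if "range e \<subseteq> D" "\<forall>\<psi>\<in>\<Gamma>. sat D E e \<psi>" for D :: "nat set" and E e
    using that assms(1) by (intro ZFC_model_infinite) blast+
qed (fact assms(2))

named_theorems definable_intros

locale zfc =
  fixes E :: "'a \<Rightarrow> 'a \<Rightarrow> bool" (infix \<open>\<epsilon>\<close> 50)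
  assumes ZFC: "\<phi> \<in> ZFC \<Longrightarrow> sat UNIV (\<epsilon>) e \<phi>"
begin

abbreviation satisfies :: "(nat \<Rightarrow> 'a) \<Rightarrow> fm \<Rightarrow> bool" (infix \<open>\<Turnstile>\<close> 50) where
  "e \<Turnstile> \<phi> \<equiv> sat UNIV (\<epsilon>) e \<phi>"

subsection \<open>Definability with parameters\<close>

text \<open>Each variable of a defining formula stands for a variable of the environment (\<open>Inl\<close>) or for
  a parameter (\<open>Inr\<close>).\<close>

definition definable :: "((nat \<Rightarrow> 'a) \<Rightarrow> bool) \<Rightarrow> bool" where
  "definable P \<longleftrightarrow> (\<exists>\<phi> r. \<forall>e. P e \<longleftrightarrow> (\<lambda>i. case_sum e id (r i)) \<Turnstile> \<phi>)"

definition is_term :: "((nat \<Rightarrow> 'a) \<Rightarrow> 'a) \<Rightarrow> bool" where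
  "is_term t \<longleftrightarrow> (\<exists>c. \<forall>e. t e = case_sum e id c)"

lemma is_term_var [definable_intros]: "is_term (\<lambda>e. e i)"
  unfolding is_term_def by (rule exI[of _ "Inl i"]) simp

lemma is_term_const [definable_intros]: "is_term (\<lambda>e. a)"
  unfolding is_term_def by (rule exI[of _ "Inr a"]) simp

lemma definable_sat: "definable (\<lambda>e. e \<Turnstile> \<phi>)"
  unfolding definable_def by (rule exI[of _ \<phi>], rule exI[of _ Inl]) simp

lemma definable_subst:
  assumes "definable P" "\<And>i. is_term (t i)"
  shows "definable (\<lambda>e. P (\<lambda>i. t i e))"
proof -
  obtain \<phi> r where P: "\<And>e. P e \<longleftrightarrow> (\<lambda>i. case_sum e id (r i)) \<Turnstile> \<phi>"
    using assms(1) unfolding definable_def by blast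
  obtain c where c: "\<And>i e. t i e = case_sum e id (c i)"
    using assms(2) unfolding is_term_def by metis
  have "case_sum (\<lambda>i. t i e) id (r i) = case_sum e id (case_sum c Inr (r i))" for i e
    by (simp add: c split: sum.split)
  then show ?thesis
    unfolding definable_def P by (intro exI[of _ \<phi>] exI[of _ "\<lambda>i. case_sum c Inr (r i)"]) simp
qed

lemma definable_subst2:
  assumes "definable (\<lambda>e. P (e 0) (e (Suc 0)))" "is_term t" "is_term u"
  shows "definable (\<lambda>e. P (t e) (u e))"
  using definable_subst[OF assms(1), of "case_nat t (\<lambda>_. u)"] assms(2,3)
  by (simp split: nat.split)

lemma definable_fm1:
  assumes "\<And>e. e \<Turnstile> \<phi> \<longleftrightarrow> P (e 0)" "is_term t"
  shows "definable (\<lambda>e. P (t e))"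
  using definable_subst[OF definable_sat[of \<phi>], of "\<lambda>_. t"] assms by simp

lemma definable_fm2:
  assumes "\<And>e. e \<Turnstile> \<phi> \<longleftrightarrow> P (e 0) (e (Suc 0))" "is_term t" "is_term u"
  shows "definable (\<lambda>e. P (t e) (u e))"
  using definable_subst[OF definable_sat[of \<phi>], of "case_nat t (\<lambda>_. u)"] assms
  by (simp split: nat.split)

lemma definable_fm3:
  assumes "\<And>e. e \<Turnstile> \<phi> \<longleftrightarrow> P (e 0) (e (Suc 0)) (e (Suc (Suc 0)))"
    and "is_term t" "is_term u" "is_term v"
  shows "definable (\<lambda>e. P (t e) (u e) (v e))"
  using definable_subst[OF definable_sat[of \<phi>], of "case_nat t (case_nat u (\<lambda>_. v))"] assms
  by (simp split: nat.split)

lemma definable_mem [definable_intros]: "is_term t \<Longrightarrow> is_term u \<Longrightarrow> definable (\<lambda>e. t e \<epsilon> u e)"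
  by (rule definable_fm2[of "0 \<^bold>\<in> Suc 0"]) simp_all

lemma definable_eq [definable_intros]: "is_term t \<Longrightarrow> is_term u \<Longrightarrow> definable (\<lambda>e. t e = u e)"
  by (rule definable_fm2[of "0 \<^bold>= Suc 0"]) simp_all

lemma definable_False [definable_intros]: "definable (\<lambda>e. False)"
  using definable_sat[of "\<^bold>\<bottom>"] by simp

lemma definable_imp [definable_intros]:
  assumes "definable P" "definable Q"
  shows "definable (\<lambda>e. P e \<longrightarrow> Q e)"
proof -
  obtain \<phi> r where P: "\<And>e. P e \<longleftrightarrow> (\<lambda>i. case_sum e id (r i)) \<Turnstile> \<phi>"
    using assms(1) unfolding definable_def by blast
  obtain \<psi> q where Q: "\<And>e. Q e \<longleftrightarrow> (\<lambda>i. case_sum e id (q i)) \<Turnstile> \<psi>"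
    using assms(2) unfolding definable_def by blast
  let ?r = "\<lambda>i. if even i then r (i div 2) else q (i div 2)"
  let ?\<chi> = "rename (\<lambda>i. 2 * i) \<phi> \<^bold>\<longrightarrow> rename (\<lambda>i. 2 * i + 1) \<psi>"
  show ?thesis
    unfolding definable_def P Q by (intro exI[of _ ?\<chi>] exI[of _ ?r]) (simp add: sat_rename)
qed

lemma definable_all [definable_intros]:
  assumes "definable (\<lambda>e. Q (e 0) (\<lambda>i. e (Suc i)))"
  shows "definable (\<lambda>e. \<forall>x. Q x e)"
proof -
  obtain \<phi> r where P: "\<And>e. Q (e 0) (\<lambda>i. e (Suc i)) \<longleftrightarrow> (\<lambda>i. case_sum e id (r i)) \<Turnstile> \<phi>"
    using assms unfolding definable_def by blast
  have Q: "Q x e \<longleftrightarrow> (\<lambda>i. case_sum (case_nat x e) id (r i)) \<Turnstile> \<phi>" for x e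
    using P[of "case_nat x e"] by simp
  define s where "s = (\<lambda>i. if r i = Inl 0 then 0 else Suc i)"
  define q where "q = (\<lambda>i. case_sum (\<lambda>j. Inl (j - 1)) Inr (r i))"
  have "case_sum (case_nat x e) id (r i) = case_nat x (\<lambda>i. case_sum e id (q i)) (s i)" for x e i
    unfolding s_def q_def by (auto split: sum.split nat.split)
  then show ?thesis
    unfolding definable_def Q
    by (intro exI[of _ "\<^bold>\<forall>(rename s \<phi>)"] exI[of _ q]) (simp add: sat_rename)
qed

lemma definable_not [definable_intros]: "definable P \<Longrightarrow> definable (\<lambda>e. \<not> P e)"
  using definable_imp[OF _ definable_False] by simp

lemma definable_conj [definable_intros]:
  "definable P \<Longrightarrow> definable Q \<Longrightarrow> definable (\<lambda>e. P e \<and> Q e)"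
  using definable_not[OF definable_imp[OF _ definable_not], of P Q] by simp

lemma definable_disj [definable_intros]:
  "definable P \<Longrightarrow> definable Q \<Longrightarrow> definable (\<lambda>e. P e \<or> Q e)"
  using definable_imp[OF definable_not, of P Q] by (simp add: disj_imp)

lemma definable_iff [definable_intros]:
  "definable P \<Longrightarrow> definable Q \<Longrightarrow> definable (\<lambda>e. P e \<longleftrightarrow> Q e)"
  using definable_conj[OF definable_imp definable_imp, of P Q Q P]
  by (simp add: iff_conv_conj_imp)

lemma definable_ex [definable_intros]:
  "definable (\<lambda>e. Q (e 0) (\<lambda>i. e (Suc i))) \<Longrightarrow> definable (\<lambda>e. \<exists>x. Q x e)"
  using definable_not[OF definable_all[OF definable_not], of Q] by simp

text \<open>Schema instances expect the parameters in the variables from some index \<open>k\<close> on.\<close>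

lemma definable_parameters_from:
  assumes "definable P" and local: "\<And>e e'. (\<And>i. i < k \<Longrightarrow> e i = e' i) \<Longrightarrow> P e \<longleftrightarrow> P e'"
  obtains \<phi> c where "\<And>e. (\<And>i. e (i + k) = c i) \<Longrightarrow> e \<Turnstile> \<phi> \<longleftrightarrow> P e"
proof -
  obtain \<phi> r where P: "\<And>e. P e \<longleftrightarrow> (\<lambda>i. case_sum e id (r i)) \<Turnstile> \<phi>"
    using assms(1) unfolding definable_def by blast
  define c where "c = (\<lambda>i. case_sum (\<lambda>_. undefined) id (r i))"
  define s where "s = (\<lambda>i. case_sum (\<lambda>j. if j < k then j else i + k) (\<lambda>_. i + k) (r i))"
  have "e \<Turnstile> rename s \<phi> \<longleftrightarrow> P e" if e: "\<And>i. e (i + k) = c i" for e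
  proof -
    let ?e = "\<lambda>i. if i < k then e i else undefined"
    have "case_sum ?e id (r i) = e (s i)" for i
      unfolding s_def using e[of i] by (auto simp: c_def split: sum.split)
    then have "P ?e \<longleftrightarrow> e \<Turnstile> rename s \<phi>" unfolding P sat_rename by simp
    moreover have "P ?e \<longleftrightarrow> P e" by (rule local) simp
    ultimately show ?thesis by simp
  qed
  then show thesis by (rule that)
qed

subsection \<open>Classes that are sets\<close>

definition small :: "('a \<Rightarrow> bool) \<Rightarrow> bool" where
  "small P \<longleftrightarrow> (\<exists>b. \<forall>z. z \<epsilon> b \<longleftrightarrow> P z)"

definition set_of :: "('a \<Rightarrow> bool) \<Rightarrow> 'a" where
  "set_of P = (THE b. \<forall>z. z \<epsilon> b \<longleftrightarrow> P z)"

lemma ext: "(\<And>z. z \<epsilon> x \<longleftrightarrow> z \<epsilon> y) \<Longrightarrow> x = y"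
  using ZFC[of extensionality] unfolding sat_extensionality by (simp add: ZFC_def)

lemma mem_set_of_iff:
  assumes "small P"
  shows "z \<epsilon> set_of P \<longleftrightarrow> P z"
proof -
  have "\<exists>!b. \<forall>z. z \<epsilon> b \<longleftrightarrow> P z" using assms unfolding small_def by (auto intro: ext)
  from theI'[OF this] show ?thesis unfolding set_of_def by blast
qed

lemma foundation_ex: "y \<epsilon> x \<Longrightarrow> \<exists>y. y \<epsilon> x \<and> (\<forall>z. z \<epsilon> y \<longrightarrow> \<not> z \<epsilon> x)"
  using ZFC[of foundation] unfolding sat_foundation by (auto simp: ZFC_def)

lemma small_pairing: "small (\<lambda>z. z = x \<or> z = y)"
  using ZFC[of pairing] unfolding sat_pairing by (simp add: ZFC_def small_def)

lemma small_union: "small (\<lambda>z. \<exists>y. y \<epsilon> x \<and> z \<epsilon> y)"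
  using ZFC[of union_ax] unfolding sat_union_ax by (simp add: ZFC_def small_def)

definition subset :: "'a \<Rightarrow> 'a \<Rightarrow> bool" (infix \<open>\<sqsubseteq>\<close> 50) where
  "x \<sqsubseteq> y \<longleftrightarrow> (\<forall>z. z \<epsilon> x \<longrightarrow> z \<epsilon> y)"

lemma satisfies_subset_fm: "e \<Turnstile> subset_fm x y \<longleftrightarrow> e x \<sqsubseteq> e y"
  by (simp add: sat_subset_fm subset_def)

lemma definable_subset [definable_intros]:
  "is_term t \<Longrightarrow> is_term u \<Longrightarrow> definable (\<lambda>e. t e \<sqsubseteq> u e)"
  by (rule definable_fm2[of "subset_fm 0 (Suc 0)"]) (simp_all add: satisfies_subset_fm)

lemma small_powerset: "small (\<lambda>z. z \<sqsubseteq> x)"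
  using ZFC[of powerset] unfolding sat_powerset by (simp add: ZFC_def small_def subset_def)

lemma satisfies_if_satisfies_All_funpow: "(\<And>e. e \<Turnstile> (All ^^ n) \<phi>) \<Longrightarrow> e \<Turnstile> \<phi>"
proof (induction n arbitrary: e)
  case (Suc n)
  have "e \<Turnstile> (All ^^ n) \<phi>" for e
  proof -
    have "(\<lambda>i. e (Suc i)) \<Turnstile> \<^bold>\<forall>((All ^^ n) \<phi>)" using Suc.prems by simp
    moreover have "case_nat (e 0) (\<lambda>i. e (Suc i)) = e" by (auto split: nat.split)
    ultimately show ?thesis by (metis UNIV_I sat.simps(5))
  qed
  then show ?case by (rule Suc.IH)
qed simp

lemma satisfies_if_closure_in_ZFC:
  assumes "\<And>n. fv ((All ^^ n) \<phi>) = {} \<Longrightarrow> (All ^^ n) \<phi> \<in> ZFC"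
  shows "e \<Turnstile> \<phi>"
proof -
  obtain n where "fv \<phi> \<subseteq> {..<n}" using fv_bounded by blast
  then have "fv ((All ^^ n) \<phi>) = {}" unfolding fv_funpow_All by auto
  then show ?thesis using ZFC[OF assms] satisfies_if_satisfies_All_funpow by blast
qed

lemma satisfies_separation: "e \<Turnstile> separation \<phi>"
  by (rule satisfies_if_closure_in_ZFC) (auto simp: ZFC_def)

lemma satisfies_replacement: "e \<Turnstile> replacement \<phi>"
  by (rule satisfies_if_closure_in_ZFC) (auto simp: ZFC_def)

lemma small_separation:
  assumes "definable (\<lambda>e. P (e 0))"
  shows "small (\<lambda>z. z \<epsilon> a \<and> P z)"
proof -
  obtain \<phi> c where \<phi>: "\<And>e. (\<And>i. e (i + 2) = c i) \<Longrightarrow> e \<Turnstile> \<phi> \<longleftrightarrow> P (e 0)"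
    by (rule definable_parameters_from[OF assms, where k = 2]) (simp, blast)
  have "case_nat z (case_nat b (case_nat a c)) \<Turnstile> rename (case_nat 0 (\<lambda>i. i + 2)) \<phi> \<longleftrightarrow> P z"
    for z b a
    unfolding sat_rename by (subst \<phi>) (simp_all add: eval_nat_numeral)
  moreover have "c \<Turnstile> separation \<phi>" by (rule satisfies_separation)
  ultimately show ?thesis by (simp add: separation_def small_def eval_nat_numeral)
qed

lemma small_replacement:
  assumes "definable (\<lambda>e. R (e 0) (e (Suc 0)))"
    and unique: "\<And>x y y'. x \<epsilon> a \<Longrightarrow> R x y \<Longrightarrow> R x y' \<Longrightarrow> y = y'"
  shows "small (\<lambda>y. \<exists>x. x \<epsilon> a \<and> R x y)"
proof -
  have "definable (\<lambda>e. R (e (Suc 0)) (e 0))"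
    by (rule definable_subst2[OF assms(1)]) (rule is_term_var)+
  then obtain \<phi> c where \<phi>: "\<And>e. (\<And>i. e (i + 3) = c i) \<Longrightarrow> e \<Turnstile> \<phi> \<longleftrightarrow> R (e (Suc 0)) (e 0)"
    by (rule definable_parameters_from[where k = 3]) (simp, blast)
  have "case_nat y' (case_nat y (case_nat x (case_nat a c))) \<Turnstile> rename Suc \<phi> \<longleftrightarrow> R x y"
    for x y y' a
    unfolding sat_rename by (subst \<phi>) (simp_all add: eval_nat_numeral)
  moreover have "case_nat y' (case_nat y (case_nat x (case_nat a c))) \<Turnstile>
      rename (case_nat 0 (\<lambda>i. i + 2)) \<phi> \<longleftrightarrow> R x y'" for x y y' a
    unfolding sat_rename by (subst \<phi>) (simp_all add: eval_nat_numeral)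
  moreover have "case_nat x (case_nat y (case_nat b (case_nat a c))) \<Turnstile>
      rename (case_nat 1 (case_nat 0 (\<lambda>i. i + 3))) \<phi> \<longleftrightarrow> R x y" for x y b a
    unfolding sat_rename by (subst \<phi>) (simp_all add: eval_nat_numeral)
  moreover have "c \<Turnstile> replacement \<phi>" by (rule satisfies_replacement)
  ultimately show ?thesis using unique by (simp add: replacement_def small_def eval_nat_numeral)
qed

lemma small_mem: "small (\<lambda>z. z \<epsilon> a)"
  unfolding small_def by blast

lemma small_UN: "small P \<Longrightarrow> small (\<lambda>z. \<exists>y. P y \<and> z \<epsilon> y)"
  using small_union unfolding small_def by metis

lemma small_disj: "small P \<Longrightarrow> small Q \<Longrightarrow> small (\<lambda>z. P z \<or> Q z)"
proof -
  assume "small P" "small Q"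
  then obtain p q where "\<And>z. z \<epsilon> p \<longleftrightarrow> P z" "\<And>z. z \<epsilon> q \<longleftrightarrow> Q z" unfolding small_def by blast
  then have "(\<exists>y. (y = p \<or> y = q) \<and> z \<epsilon> y) \<longleftrightarrow> P z \<or> Q z" for z by blast
  then show ?thesis using small_UN[OF small_pairing[of p q]] by simp
qed

definition emptyset :: 'a where
  "emptyset = set_of (\<lambda>_. False)"

definition upair :: "'a \<Rightarrow> 'a \<Rightarrow> 'a" where
  "upair x y = set_of (\<lambda>z. z = x \<or> z = y)"

definition union :: "'a \<Rightarrow> 'a" where
  "union x = set_of (\<lambda>z. \<exists>y. y \<epsilon> x \<and> z \<epsilon> y)"

definition succ :: "'a \<Rightarrow> 'a" where
  "succ x = set_of (\<lambda>z. z \<epsilon> x \<or> z = x)"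

lemma mem_emptyset [simp]: "\<not> z \<epsilon> emptyset"
  using mem_set_of_iff[of "\<lambda>_. False"] small_separation[OF definable_False]
  unfolding emptyset_def by simp

lemma mem_upair_iff [simp]: "z \<epsilon> upair x y \<longleftrightarrow> z = x \<or> z = y"
  unfolding upair_def by (rule mem_set_of_iff[OF small_pairing])

lemma mem_union_iff [simp]: "z \<epsilon> union x \<longleftrightarrow> (\<exists>y. y \<epsilon> x \<and> z \<epsilon> y)"
  unfolding union_def by (rule mem_set_of_iff[OF small_union])

lemma mem_succ_iff [simp]: "z \<epsilon> succ x \<longleftrightarrow> z \<epsilon> x \<or> z = x"
  unfolding succ_def using small_disj[OF small_mem small_pairing, of x x x]
  by (intro mem_set_of_iff) simp

lemma mem_irrefl [simp]: "\<not> x \<epsilon> x"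
  using foundation_ex[of x "upair x x"] by auto

definition is_succ :: "'a \<Rightarrow> 'a \<Rightarrow> bool" where
  "is_succ s x \<longleftrightarrow> s = succ x"

lemma satisfies_succ_fm: "e \<Turnstile> succ_fm s x \<longleftrightarrow> is_succ (e s) (e x)"
  using ext[of "e s" "succ (e x)"] by (auto simp: sat_succ_fm is_succ_def)

lemma definable_is_succ [definable_intros]:
  "is_term t \<Longrightarrow> is_term u \<Longrightarrow> definable (\<lambda>e. is_succ (t e) (u e))"
  by (rule definable_fm2[of "succ_fm 0 (Suc 0)"]) (simp_all add: satisfies_succ_fm)

subsection \<open>Ordinals\<close>

definition transitive :: "'a \<Rightarrow> bool" where
  "transitive x \<longleftrightarrow> (\<forall>y. y \<epsilon> x \<longrightarrow> y \<sqsubseteq> x)"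

definition ord :: "'a \<Rightarrow> bool" where
  "ord x \<longleftrightarrow> transitive x \<and> (\<forall>y. y \<epsilon> x \<longrightarrow> transitive y)"

lemma satisfies_ord_fm: "e \<Turnstile> ord_fm x \<longleftrightarrow> ord (e x)"
  unfolding ord_fm_def transitive_fm_def ord_def transitive_def
  by (simp add: satisfies_subset_fm)

lemma definable_ord [definable_intros]: "is_term t \<Longrightarrow> definable (\<lambda>e. ord (t e))"
  by (rule definable_fm1[of "ord_fm 0"]) (simp_all add: satisfies_ord_fm)

lemma transitiveD: "transitive x \<Longrightarrow> y \<epsilon> x \<Longrightarrow> z \<epsilon> y \<Longrightarrow> z \<epsilon> x"
  unfolding transitive_def subset_def by blast

lemma ord_trans: "ord a \<Longrightarrow> b \<epsilon> a \<Longrightarrow> c \<epsilon> b \<Longrightarrow> c \<epsilon> a"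
  unfolding ord_def using transitiveD by blast

lemma ord_mem: "ord a \<Longrightarrow> b \<epsilon> a \<Longrightarrow> ord b"
  unfolding ord_def using transitiveD by blast

lemma ord_emptyset: "ord emptyset"
  unfolding ord_def transitive_def by simp

lemma ord_succ: "ord a \<Longrightarrow> ord (succ a)"
  unfolding ord_def transitive_def subset_def mem_succ_iff by blast

lemma ord_union: "(\<And>b. b \<epsilon> A \<Longrightarrow> ord b) \<Longrightarrow> ord (union A)"
  unfolding ord_def transitive_def subset_def mem_union_iff by blast

lemma transitive_induct:
  assumes "definable (\<lambda>e. P (e 0))" and t: "transitive t"
    and step: "\<And>x. x \<epsilon> t \<Longrightarrow> (\<And>y. y \<epsilon> x \<Longrightarrow> P y) \<Longrightarrow> P x"
  shows "x \<epsilon> t \<Longrightarrow> P x"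
proof (rule ccontr)
  assume "x \<epsilon> t" "\<not> P x"
  obtain B where B: "\<And>z. z \<epsilon> B \<longleftrightarrow> z \<epsilon> t \<and> \<not> P z"
    using small_separation[OF definable_not[OF assms(1)], of t] unfolding small_def by blast
  then have "x \<epsilon> B" using \<open>x \<epsilon> t\<close> \<open>\<not> P x\<close> by simp
  then obtain b where "b \<epsilon> B" "\<And>z. z \<epsilon> b \<Longrightarrow> \<not> z \<epsilon> B" using foundation_ex by blast
  then show False using step[of b] B transitiveD[OF t] by blast
qed

lemma ord_induct [consumes 2, case_names step]:
  assumes "definable (\<lambda>e. P (e 0))" "ord a"
    and step: "\<And>a. ord a \<Longrightarrow> (\<And>b. b \<epsilon> a \<Longrightarrow> P b) \<Longrightarrow> P a"
  shows "P a"
proof (rule transitive_induct[OF assms(1)])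
  have a: "ord (succ a)" using assms(2) by (rule ord_succ)
  then show "transitive (succ a)" unfolding ord_def by blast
  show "P b" if "b \<epsilon> succ a" "\<And>c. c \<epsilon> b \<Longrightarrow> P c" for b
    using that step ord_mem[OF a] by blast
qed simp

lemma ord_least:
  assumes "definable (\<lambda>e. P (e 0))" "ord a" "P a"
  shows "\<exists>b. ord b \<and> P b \<and> (\<forall>c. c \<epsilon> b \<longrightarrow> \<not> P c)"
  using ord_induct[of "\<lambda>x. \<not> P x", OF definable_not[OF assms(1)] assms(2)] assms(3) by blast

lemma ord_linear:
  assumes "ord a" "ord b"
  shows "a \<epsilon> b \<or> a = b \<or> b \<epsilon> a"
proof -
  have "definable (\<lambda>e. \<forall>b. ord b \<longrightarrow> e 0 \<epsilon> b \<or> e 0 = b \<or> b \<epsilon> e 0)"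
    by (intro definable_intros)
  then have "\<forall>b. ord b \<longrightarrow> a \<epsilon> b \<or> a = b \<or> b \<epsilon> a" using assms(1)
  proof (induction rule: ord_induct)
    case outer: (step a)
    have "a \<epsilon> b \<or> a = b \<or> b \<epsilon> a" if "ord b" for b
    proof -
      have "definable (\<lambda>e. a \<epsilon> e 0 \<or> a = e 0 \<or> e 0 \<epsilon> a)" by (intro definable_intros)
      then show ?thesis using that
      proof (induction rule: ord_induct)
        case inner: (step b)
        show ?case
        proof (rule ccontr)
          assume incomparable: "\<not> (a \<epsilon> b \<or> a = b \<or> b \<epsilon> a)"
          have "y \<epsilon> b" if "y \<epsilon> a" for y
            using outer.IH[OF that] outer.hyps inner.hyps incomparable that ord_trans by blast
          moreover have "y \<epsilon> a" if "y \<epsilon> b" for y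
            using inner.IH[OF that] inner.hyps incomparable that ord_trans by blast
          ultimately show False using incomparable ext by blast
        qed
      qed
    qed
    then show ?case by blast
  qed
  then show ?thesis using assms(2) by blast
qed

definition ord_le :: "'a \<Rightarrow> 'a \<Rightarrow> bool" (infix \<open>\<preceq>\<close> 50) where
  "a \<preceq> b \<longleftrightarrow> a \<epsilon> b \<or> a = b"

lemma satisfies_le_fm: "e \<Turnstile> le_fm x y \<longleftrightarrow> e x \<preceq> e y"
  by (simp add: le_fm_def ord_le_def)

lemma ord_le_refl [simp]: "a \<preceq> a"
  unfolding ord_le_def by simp

lemma ord_le_trans: "ord c \<Longrightarrow> a \<preceq> b \<Longrightarrow> b \<preceq> c \<Longrightarrow> a \<preceq> c"
  unfolding ord_le_def using ord_trans by blast

lemma ord_le_total: "ord a \<Longrightarrow> ord b \<Longrightarrow> a \<preceq> b \<or> b \<preceq> a"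
  unfolding ord_le_def using ord_linear by blast

lemma ord_le_succ: "a \<preceq> succ a"
  unfolding ord_le_def by simp

lemma ord_le_if_subset: "ord a \<Longrightarrow> ord b \<Longrightarrow> a \<sqsubseteq> b \<Longrightarrow> a \<preceq> b"
  using ord_linear unfolding ord_le_def subset_def by (metis mem_irrefl)

definition limit :: "'a \<Rightarrow> bool" where
  "limit l \<longleftrightarrow> ord l \<and> emptyset \<epsilon> l \<and> (\<forall>a. a \<epsilon> l \<longrightarrow> succ a \<epsilon> l)"

text \<open>The supremum of the ordinals in an inductive set is a limit.\<close>

lemma limit_ex: "\<exists>l. limit l"
proof -
  obtain i z where z: "z \<epsilon> i" "\<And>x. \<not> x \<epsilon> z"
    and i: "\<And>x. x \<epsilon> i \<Longrightarrow> \<exists>s. s \<epsilon> i \<and> (\<forall>z. z \<epsilon> s \<longleftrightarrow> z \<epsilon> x \<or> z = x)"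
    using ZFC[of infinity] unfolding sat_infinity by (auto simp: ZFC_def)
  have "z = emptyset" using z(2) by (intro ext) simp
  obtain A where A: "\<And>a. a \<epsilon> A \<longleftrightarrow> a \<epsilon> i \<and> ord a"
    using small_separation[of ord i] definable_ord[OF is_term_var] unfolding small_def by blast
  have succ_A: "succ a \<epsilon> A" if "a \<epsilon> A" for a
    using i[of a] that ext[of _ "succ a"] A ord_succ by auto
  have "emptyset \<epsilon> A" using z(1) \<open>z = emptyset\<close> A ord_emptyset by simp
  then have "emptyset \<epsilon> union A" using succ_A by fastforce
  moreover have "succ a \<epsilon> union A" if "a \<epsilon> union A" for a
  proof -
    obtain b where b: "a \<epsilon> b" "b \<epsilon> A" using \<open>a \<epsilon> union A\<close> by auto
    then have "ord b" using A by blast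
    then have "succ a \<sqsubseteq> b" unfolding subset_def using b(1) ord_trans by auto
    then have "succ a \<preceq> b" using ord_le_if_subset ord_succ ord_mem \<open>ord b\<close> b(1) by blast
    then have "succ a \<epsilon> succ b" unfolding ord_le_def by simp
    then show ?thesis using succ_A[OF b(2)] by auto
  qed
  moreover have "ord (union A)" using A by (intro ord_union) blast
  ultimately show ?thesis unfolding limit_def by blast
qed

subsection \<open>Ordered pairs and functions\<close>

definition opair :: "'a \<Rightarrow> 'a \<Rightarrow> 'a" where
  "opair x y = upair (upair x x) (upair x y)"

definition is_opair :: "'a \<Rightarrow> 'a \<Rightarrow> 'a \<Rightarrow> bool" where
  "is_opair p x y \<longleftrightarrow> p = opair x y"

definition app :: "'a \<Rightarrow> 'a \<Rightarrow> 'a \<Rightarrow> bool" where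
  "app f x y \<longleftrightarrow> opair x y \<epsilon> f"

definition is_function :: "'a \<Rightarrow> 'a \<Rightarrow> bool" where
  "is_function f d \<longleftrightarrow> (\<forall>p. p \<epsilon> f \<longrightarrow> (\<exists>x. x \<epsilon> d \<and> (\<exists>y. is_opair p x y))) \<and>
     (\<forall>x. x \<epsilon> d \<longrightarrow> (\<exists>y. \<forall>y'. app f x y' \<longleftrightarrow> y' = y))"

lemma upair_eq_iff: "upair x y = upair x' y' \<longleftrightarrow> x = x' \<and> y = y' \<or> x = y' \<and> y = x'"
proof
  assume "upair x y = upair x' y'"
  then show "x = x' \<and> y = y' \<or> x = y' \<and> y = x'" by (metis mem_upair_iff)
qed (auto intro: ext)

lemma opair_eq_iff [simp]: "opair x y = opair x' y' \<longleftrightarrow> x = x' \<and> y = y'"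
  unfolding opair_def upair_eq_iff by metis

lemma satisfies_upair_fm: "e \<Turnstile> upair_fm z x y \<longleftrightarrow> e z = upair (e x) (e y)"
  using ext[of "e z" "upair (e x) (e y)"] by (auto simp: upair_fm_def)

lemma satisfies_pair_fm: "e \<Turnstile> pair_fm p x y \<longleftrightarrow> is_opair (e p) (e x) (e y)"
  using ext[of "e p" "opair (e x) (e y)"]
  by (auto simp: pair_fm_def satisfies_upair_fm is_opair_def opair_def)

lemma definable_is_opair [definable_intros]:
  "is_term t \<Longrightarrow> is_term u \<Longrightarrow> is_term v \<Longrightarrow> definable (\<lambda>e. is_opair (t e) (u e) (v e))"
  by (rule definable_fm3[of "pair_fm 0 (Suc 0) (Suc (Suc 0))"]) (simp_all add: satisfies_pair_fm)

lemma satisfies_app_fm: "e \<Turnstile> app_fm f x y \<longleftrightarrow> app (e f) (e x) (e y)"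
  by (simp add: app_fm_def satisfies_pair_fm app_def is_opair_def)

lemma definable_app [definable_intros]:
  "is_term t \<Longrightarrow> is_term u \<Longrightarrow> is_term v \<Longrightarrow> definable (\<lambda>e. app (t e) (u e) (v e))"
  by (rule definable_fm3[of "app_fm 0 (Suc 0) (Suc (Suc 0))"]) (simp_all add: satisfies_app_fm)

lemma satisfies_function_fm: "e \<Turnstile> function_fm f d \<longleftrightarrow> is_function (e f) (e d)"
  by (simp add: function_fm_def is_function_def satisfies_pair_fm satisfies_app_fm eval_nat_numeral)

lemma definable_is_function [definable_intros]:
  "is_term t \<Longrightarrow> is_term u \<Longrightarrow> definable (\<lambda>e. is_function (t e) (u e))"
  by (rule definable_fm2[of "function_fm 0 (Suc 0)"]) (simp_all add: satisfies_function_fm)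

lemma function_graph_ex:
  assumes R: "definable (\<lambda>e. R (e 0) (e (Suc 0)))" and "\<And>x. x \<epsilon> d \<Longrightarrow> \<exists>!y. R x y"
  shows "\<exists>f. is_function f d \<and> (\<forall>x y. app f x y \<longleftrightarrow> x \<epsilon> d \<and> R x y)"
proof -
  let ?P = "\<lambda>x p. \<exists>y. R x y \<and> is_opair p x y"
  have "definable (\<lambda>e. ?P (e 0) (e (Suc 0)))"
    by (intro definable_intros definable_subst2[OF R])
  then have "small (\<lambda>p. \<exists>x. x \<epsilon> d \<and> ?P x p)"
    by (rule small_replacement) (use assms(2) in \<open>auto simp: is_opair_def\<close>)
  then obtain f where f: "\<And>p. p \<epsilon> f \<longleftrightarrow> (\<exists>x. x \<epsilon> d \<and> ?P x p)" unfolding small_def by blast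
  have app_f: "app f x y \<longleftrightarrow> x \<epsilon> d \<and> R x y" for x y unfolding app_def f by (auto simp: is_opair_def)
  moreover have "is_function f d" unfolding is_function_def using f app_f assms(2) by metis
  ultimately show ?thesis by blast
qed

subsection \<open>Recursion along the ordinals\<close>

text \<open>The recursion \<open>v(\<alpha>) = x \<union> {z. \<exists>\<eta> < \<alpha>. Q z (v(\<eta>))}\<close> covers both the cumulative
  hierarchy and transitive closures.\<close>

definition recursive :: "'a \<Rightarrow> ('a \<Rightarrow> 'a \<Rightarrow> bool) \<Rightarrow> 'a \<Rightarrow> 'a \<Rightarrow> bool" where
  "recursive x Q f d \<longleftrightarrow> is_function f d \<and> (\<forall>a. a \<epsilon> d \<longrightarrow> (\<forall>v. app f a v \<longrightarrow>
     (\<forall>z. z \<epsilon> v \<longleftrightarrow> z \<epsilon> x \<or> (\<exists>b. b \<epsilon> a \<and> (\<exists>u. app f b u \<and> Q z u)))))"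

definition stage :: "'a \<Rightarrow> ('a \<Rightarrow> 'a \<Rightarrow> bool) \<Rightarrow> 'a \<Rightarrow> 'a \<Rightarrow> bool" where
  "stage x Q a v \<longleftrightarrow> (\<exists>s. is_succ s a \<and> (\<exists>f. recursive x Q f s \<and> app f a v))"

definition next_stage :: "'a \<Rightarrow> ('a \<Rightarrow> 'a \<Rightarrow> bool) \<Rightarrow> 'a \<Rightarrow> 'a \<Rightarrow> bool" where
  "next_stage x Q a v \<longleftrightarrow> (\<forall>z. z \<epsilon> v \<longleftrightarrow> z \<epsilon> x \<or> (\<exists>b. b \<epsilon> a \<and> (\<exists>u. stage x Q b u \<and> Q z u)))"

lemma stage_iff: "stage x Q a v \<longleftrightarrow> (\<exists>f. recursive x Q f (succ a) \<and> app f a v)"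
  unfolding stage_def is_succ_def by simp

lemma recursive_value: "recursive x Q f d \<Longrightarrow> a \<epsilon> d \<Longrightarrow> \<exists>!v. app f a v"
  unfolding recursive_def is_function_def by metis

lemma recursive_mem_iff:
  "recursive x Q f d \<Longrightarrow> a \<epsilon> d \<Longrightarrow> app f a v \<Longrightarrow>
    z \<epsilon> v \<longleftrightarrow> z \<epsilon> x \<or> (\<exists>b. b \<epsilon> a \<and> (\<exists>u. app f b u \<and> Q z u))"
  unfolding recursive_def by blast

lemma recursive_unique:
  assumes d: "ord d" and f: "recursive x Q f d" and d': "ord d'" and f': "recursive x Q f' d'"
  shows "a \<epsilon> d \<Longrightarrow> a \<epsilon> d' \<Longrightarrow> app f a v \<Longrightarrow> app f' a v' \<Longrightarrow> v = v'"
proof -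
  assume a: "a \<epsilon> d" "a \<epsilon> d'" "app f a v" "app f' a v'"
  let ?P = "\<lambda>a. a \<epsilon> d' \<longrightarrow> (\<forall>v v'. app f a v \<longrightarrow> app f' a v' \<longrightarrow> v = v')"
  have "definable (\<lambda>e. ?P (e 0))" by (intro definable_intros)
  moreover have "transitive d" using d unfolding ord_def by blast
  ultimately have "?P a" using _ a(1)
  proof (rule transitive_induct, intro impI allI)
    fix a v v'
    assume a: "a \<epsilon> d" "a \<epsilon> d'" "app f a v" "app f' a v'" and IH: "\<And>b. b \<epsilon> a \<Longrightarrow> ?P b"
    have "app f b u \<longleftrightarrow> app f' b u" if "b \<epsilon> a" for b u
    proof -
      have "b \<epsilon> d" "b \<epsilon> d'" using that a(1,2) d d' ord_trans by blast+
      then show ?thesis using IH[OF that] recursive_value[OF f] recursive_value[OF f'] by metis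
    qed
    then show "v = v'"
      using recursive_mem_iff[OF f a(1,3)] recursive_mem_iff[OF f' a(2,4)] by (intro ext) blast
  qed
  then show "v = v'" using a by blast
qed

lemma stage_unique: "ord a \<Longrightarrow> stage x Q a v \<Longrightarrow> stage x Q a v' \<Longrightarrow> v = v'"
  unfolding stage_iff using recursive_unique[of "succ a" x Q _ "succ a" _ a] ord_succ by auto

lemma recursive_app_iff_stage:
  assumes d: "ord d" "recursive x Q f d" "a \<epsilon> d" and ex: "\<exists>u. stage x Q a u"
  shows "app f a v \<longleftrightarrow> stage x Q a v"
proof -
  have a: "ord a" using d ord_mem by blast
  have "v = u" if "app f a v" "stage x Q a u" for u v
    using that recursive_unique[OF d(1,2) ord_succ[OF a]] d(3) unfolding stage_iff by auto
  then show ?thesis using ex recursive_value[OF d(2,3)] by metis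
qed

lemma stage_imp_next_stage:
  assumes "ord a" "stage x Q a v" "\<And>b. b \<epsilon> a \<Longrightarrow> \<exists>u. stage x Q b u"
  shows "next_stage x Q a v"
proof -
  obtain f where f: "recursive x Q f (succ a)" "app f a v" using assms(2) stage_iff by blast
  have "app f b u \<longleftrightarrow> stage x Q b u" if "b \<epsilon> a" for b u
    using recursive_app_iff_stage[OF ord_succ[OF assms(1)] f(1)] assms(3) that by simp
  then show ?thesis using recursive_mem_iff[OF f(1) _ f(2)] unfolding next_stage_def by auto
qed

lemma next_stage_unique: "next_stage x Q a v \<Longrightarrow> next_stage x Q a v' \<Longrightarrow> v = v'"
  unfolding next_stage_def by (intro ext) blast

context
  fixes x :: 'a and Q :: "'a \<Rightarrow> 'a \<Rightarrow> bool"
  assumes definable_Q: "definable (\<lambda>e. Q (e 0) (e (Suc 0)))"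
    and small_Q: "\<And>u. small (\<lambda>z. Q z u)"
begin

lemma definable_stage:
  "is_term t \<Longrightarrow> is_term u \<Longrightarrow> definable (\<lambda>e. stage x Q (t e) (u e))"
proof (rule definable_subst2[of "stage x Q"])
  show "definable (\<lambda>e. stage x Q (e 0) (e (Suc 0)))"
    unfolding stage_def recursive_def by (intro definable_intros definable_subst2[OF definable_Q])
qed

lemma next_stage_ex:
  assumes "ord a"
  shows "\<exists>v. next_stage x Q a v"
proof -
  let ?R = "\<lambda>b s. \<exists>u. stage x Q b u \<and> (\<forall>z. z \<epsilon> s \<longleftrightarrow> Q z u)"
  have "small (\<lambda>s. \<exists>b. b \<epsilon> a \<and> ?R b s)"
  proof (rule small_replacement)
    show "definable (\<lambda>e. ?R (e 0) (e (Suc 0)))"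
      by (intro definable_intros definable_stage definable_subst2[OF definable_Q])
    show "s = s'" if "b \<epsilon> a" "?R b s" "?R b s'" for b s s'
      using that ord_mem[OF assms] stage_unique by (intro ext) blast
  qed
  then have "small (\<lambda>z. z \<epsilon> x \<or> (\<exists>s. (\<exists>b. b \<epsilon> a \<and> ?R b s) \<and> z \<epsilon> s))"
    by (intro small_disj small_mem small_UN)
  moreover have "(\<exists>s. (\<exists>b. b \<epsilon> a \<and> ?R b s) \<and> z \<epsilon> s) \<longleftrightarrow>
      (\<exists>b. b \<epsilon> a \<and> (\<exists>u. stage x Q b u \<and> Q z u))" for z
    using small_Q unfolding small_def by metis
  ultimately show ?thesis unfolding next_stage_def small_def by simp
qed

lemma next_stage_imp_stage:
  assumes a: "ord a" and ex: "\<And>b. b \<epsilon> a \<Longrightarrow> \<exists>u. stage x Q b u" and v: "next_stage x Q a v"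
  shows "stage x Q a v"
proof -
  have ord: "ord b" if "b \<epsilon> succ a" for b using that ord_mem[OF ord_succ[OF a]] by blast
  have "definable (\<lambda>e. next_stage x Q (e 0) (e (Suc 0)))"
    unfolding next_stage_def
    by (intro definable_intros definable_stage definable_subst2[OF definable_Q])
  then have "\<exists>f. is_function f (succ a) \<and> (\<forall>b v. app f b v \<longleftrightarrow> b \<epsilon> succ a \<and> next_stage x Q b v)"
    by (rule function_graph_ex) (use next_stage_ex ord next_stage_unique in blast)
  then obtain f where f: "is_function f (succ a)"
    and app_f: "\<And>b v. app f b v \<longleftrightarrow> b \<epsilon> succ a \<and> next_stage x Q b v"
    by blast
  have stage: "stage x Q b u \<longleftrightarrow> app f b u" if "b \<epsilon> a" for b u
  proof -
    have "next_stage x Q b u" if "stage x Q b u" for u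
      using stage_imp_next_stage[of b] that \<open>b \<epsilon> a\<close> ord ex ord_trans[OF a] by simp
    then show ?thesis
      using ex[OF that] that next_stage_unique unfolding app_f by (metis mem_succ_iff)
  qed
  have "recursive x Q f (succ a)"
    unfolding recursive_def
  proof (intro conjI allI impI f)
    fix b w z assume b: "b \<epsilon> succ a" "app f b w"
    then have "next_stage x Q b w" using app_f by blast
    moreover have "stage x Q c u \<longleftrightarrow> app f c u" if "c \<epsilon> b" for c u
      using b(1) that stage ord_trans[OF a] by auto
    ultimately show "z \<epsilon> w \<longleftrightarrow> z \<epsilon> x \<or> (\<exists>c. c \<epsilon> b \<and> (\<exists>u. app f c u \<and> Q z u))"
      unfolding next_stage_def by blast
  qed
  moreover have "app f a v" using v unfolding app_f by simp
  ultimately show ?thesis unfolding stage_iff by blast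
qed

lemma stage_ex: "ord a \<Longrightarrow> \<exists>v. stage x Q a v"
proof -
  assume "ord a"
  have "definable (\<lambda>e. \<exists>v. stage x Q (e 0) v)" by (intro definable_intros definable_stage)
  then show ?thesis using \<open>ord a\<close>
  proof (induction rule: ord_induct)
    case (step a)
    then show ?case using next_stage_ex next_stage_imp_stage by blast
  qed
qed

lemma mem_stage_iff:
  "ord a \<Longrightarrow> stage x Q a v \<Longrightarrow>
    z \<epsilon> v \<longleftrightarrow> z \<epsilon> x \<or> (\<exists>b. b \<epsilon> a \<and> (\<exists>u. stage x Q b u \<and> Q z u))"
  using stage_imp_next_stage stage_ex ord_mem unfolding next_stage_def by blast

end

lemma transitive_superset_ex: "\<exists>t. transitive t \<and> x \<sqsubseteq> t"
proof -
  let ?Q = "\<lambda>z u. \<exists>w. w \<epsilon> u \<and> z \<epsilon> w"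
  have Q: "definable (\<lambda>e. ?Q (e 0) (e (Suc 0)))" "\<And>u. small (\<lambda>z. ?Q z u)"
    by (intro definable_intros) (rule small_union)
  note mem = mem_stage_iff[OF Q, of _ x]
  obtain l where "limit l" using limit_ex by blast
  then have l: "ord l" "emptyset \<epsilon> l" "\<And>a. a \<epsilon> l \<Longrightarrow> succ a \<epsilon> l" unfolding limit_def by blast+
  obtain t where t: "stage x ?Q l t" using stage_ex[OF Q l(1)] by blast
  have earlier: "\<exists>b u. b \<epsilon> l \<and> stage x ?Q b u \<and> w \<epsilon> u" if "w \<epsilon> t" for w
  proof (cases "w \<epsilon> x")
    case True
    then show ?thesis using stage_ex[OF Q ord_emptyset] mem[OF ord_emptyset] l(2) by blast
  next
    case False
    then obtain b u where b: "b \<epsilon> l" "stage x ?Q b u" "?Q w u" using \<open>w \<epsilon> t\<close> mem[OF l(1) t] by blast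
    have "ord (succ b)" using b(1) l(1) ord_mem ord_succ by blast
    then obtain u' where u': "stage x ?Q (succ b) u'" using stage_ex[OF Q] by blast
    then have "w \<epsilon> u'" using mem[OF \<open>ord (succ b)\<close> u', of w] b(2,3) by auto
    then show ?thesis using u' l(3)[OF b(1)] by blast
  qed
  have "transitive t"
    unfolding transitive_def subset_def using earlier mem[OF l(1) t] by blast
  moreover have "x \<sqsubseteq> t" unfolding subset_def using mem[OF l(1) t] by blast
  ultimately show ?thesis by blast
qed

lemma mem_induct [consumes 1, case_names step]:
  assumes "definable (\<lambda>e. P (e 0))" and step: "\<And>x. (\<And>y. y \<epsilon> x \<Longrightarrow> P y) \<Longrightarrow> P x"
  shows "P x"
proof -
  obtain t where t: "transitive t" "upair x x \<sqsubseteq> t" using transitive_superset_ex by blast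
  then have "x \<epsilon> t" unfolding subset_def by simp
  then show ?thesis using transitive_induct[OF assms(1) t(1)] step by blast
qed

subsection \<open>The cumulative hierarchy\<close>

definition V :: "'a \<Rightarrow> 'a set" where
  "V b = {x. \<exists>v. stage emptyset (\<sqsubseteq>) b v \<and> x \<epsilon> v}"

lemma satisfies_hierarchy_fm: "e \<Turnstile> hierarchy_fm f d \<longleftrightarrow> recursive emptyset (\<sqsubseteq>) (e f) (e d)"
  by (simp add: hierarchy_fm_def recursive_def satisfies_function_fm satisfies_app_fm
      satisfies_subset_fm eval_nat_numeral)

lemma satisfies_in_V_fm: "e \<Turnstile> in_V_fm x b \<longleftrightarrow> e x \<in> V (e b)"
  by (simp add: in_V_fm_def V_fm_def V_def stage_def satisfies_succ_fm satisfies_hierarchy_fm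
      satisfies_app_fm eval_nat_numeral)

lemma definable_in_V [definable_intros]:
  "is_term t \<Longrightarrow> is_term u \<Longrightarrow> definable (\<lambda>e. t e \<in> V (u e))"
  by (rule definable_fm2[of "in_V_fm 0 (Suc 0)"]) (simp_all add: satisfies_in_V_fm)

lemma definable_subset_small:
  "definable (\<lambda>e. e 0 \<sqsubseteq> e (Suc 0))" "small (\<lambda>z. z \<sqsubseteq> u)"
  by (intro definable_intros) (rule small_powerset)

lemma V_stage_ex:
  assumes "ord b"
  shows "\<exists>v. stage emptyset (\<sqsubseteq>) b v \<and> V b = {x. x \<epsilon> v}"
proof -
  obtain v where "stage emptyset (\<sqsubseteq>) b v" using stage_ex[OF definable_subset_small assms] by blast
  then show ?thesis unfolding V_def using stage_unique[OF assms] by blast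
qed

lemma in_V_iff:
  assumes "ord b"
  shows "x \<in> V b \<longleftrightarrow> (\<exists>c. c \<epsilon> b \<and> (\<forall>y. y \<epsilon> x \<longrightarrow> y \<in> V c))"
proof -
  obtain v where v: "stage emptyset (\<sqsubseteq>) b v" "V b = {x. x \<epsilon> v}" using V_stage_ex[OF assms] by blast
  have "x \<in> V b \<longleftrightarrow> (\<exists>c. c \<epsilon> b \<and> (\<exists>u. stage emptyset (\<sqsubseteq>) c u \<and> x \<sqsubseteq> u))"
    using mem_stage_iff[OF definable_subset_small assms v(1)] v(2) by simp
  moreover have "(\<exists>u. stage emptyset (\<sqsubseteq>) c u \<and> x \<sqsubseteq> u) \<longleftrightarrow> (\<forall>y. y \<epsilon> x \<longrightarrow> y \<in> V c)" if "c \<epsilon> b" for c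
  proof -
    have "ord c" using assms that by (rule ord_mem)
    then obtain u where "stage emptyset (\<sqsubseteq>) c u" "V c = {x. x \<epsilon> u}" using V_stage_ex by blast
    then show ?thesis using stage_unique[OF \<open>ord c\<close>] unfolding subset_def by blast
  qed
  ultimately show ?thesis by blast
qed

lemma V_mono: "ord c \<Longrightarrow> b \<preceq> c \<Longrightarrow> V b \<subseteq> V c"
  using in_V_iff ord_mem ord_trans unfolding ord_le_def by blast

lemma V_transitive: "ord b \<Longrightarrow> x \<in> V b \<Longrightarrow> y \<epsilon> x \<Longrightarrow> y \<in> V b"
  using in_V_iff[of b x] V_mono[of b] unfolding ord_le_def by blast

lemma in_V_succ_iff:
  assumes "ord b"
  shows "x \<in> V (succ b) \<longleftrightarrow> (\<forall>y. y \<epsilon> x \<longrightarrow> y \<in> V b)"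
proof -
  have "V c \<subseteq> V b" if "c \<epsilon> succ b" for c using that V_mono[OF assms] unfolding ord_le_def by auto
  then show ?thesis using in_V_iff[OF ord_succ[OF assms]] by (meson mem_succ_iff subsetD)
qed

lemma ord_in_V_imp_mem:
  assumes "ord a" "ord b" "a \<in> V b"
  shows "a \<epsilon> b"
proof -
  have "definable (\<lambda>e. \<forall>a. ord a \<longrightarrow> a \<in> V (e 0) \<longrightarrow> a \<epsilon> e 0)" by (intro definable_intros)
  then have "\<forall>a. ord a \<longrightarrow> a \<in> V b \<longrightarrow> a \<epsilon> b" using assms(2)
  proof (induction rule: ord_induct)
    case (step b)
    have "a \<epsilon> b" if a: "ord a" "a \<in> V b" for a
    proof -
      obtain c where c: "c \<epsilon> b" "\<And>y. y \<epsilon> a \<Longrightarrow> y \<in> V c" using in_V_iff[OF step.hyps] a(2) by blast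
      then have "a \<sqsubseteq> c" unfolding subset_def using step.IH a(1) ord_mem by blast
      then have "a \<preceq> c" using ord_le_if_subset a(1) c(1) step.hyps ord_mem by blast
      then show ?thesis unfolding ord_le_def using c(1) step.hyps ord_trans by blast
    qed
    then show ?case by blast
  qed
  then show ?thesis using assms(1,3) by blast
qed

lemma mem_ord_imp_in_V:
  assumes "ord b" "a \<epsilon> b"
  shows "a \<in> V b"
proof -
  have "definable (\<lambda>e. \<forall>b. ord b \<longrightarrow> e 0 \<epsilon> b \<longrightarrow> e 0 \<in> V b)" by (intro definable_intros)
  moreover have "ord a" using assms by (rule ord_mem)
  ultimately have "\<forall>b. ord b \<longrightarrow> a \<epsilon> b \<longrightarrow> a \<in> V b"
    by (induction rule: ord_induct) (use in_V_iff in blast)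
  then show ?thesis using assms by blast
qed

lemma in_some_V: "\<exists>b. ord b \<and> x \<in> V b"
proof -
  have "definable (\<lambda>e. \<exists>b. ord b \<and> e 0 \<in> V b)" by (intro definable_intros)
  then show ?thesis
  proof (induction x rule: mem_induct)
    case (step x)
    let ?rank = "\<lambda>y b. ord b \<and> y \<in> V b \<and> (\<forall>c. c \<epsilon> b \<longrightarrow> y \<notin> V c)"
    have "small (\<lambda>b. \<exists>y. y \<epsilon> x \<and> ?rank y b)"
    proof (rule small_replacement)
      show "definable (\<lambda>e. ?rank (e 0) (e (Suc 0)))" by (intro definable_intros)
      show "b = b'" if "?rank y b" "?rank y b'" for y b b' using that ord_linear by blast
    qed
    then obtain A where A: "\<And>b. b \<epsilon> A \<longleftrightarrow> (\<exists>y. y \<epsilon> x \<and> ?rank y b)" unfolding small_def by blast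
    have ord_A: "ord (union A)" using A by (intro ord_union) blast
    have "y \<in> V (union A)" if y: "y \<epsilon> x" for y
    proof -
      have "definable (\<lambda>e. y \<in> V (e 0))" by (intro definable_intros)
      then obtain b where b: "?rank y b" using step[OF y] ord_least[of "\<lambda>b. y \<in> V b"] by blast
      then have "b \<sqsubseteq> union A" unfolding subset_def using A y by auto
      then show ?thesis using b V_mono[OF ord_A] ord_le_if_subset ord_A by blast
    qed
    then show ?case using in_V_succ_iff[OF ord_A] ord_succ[OF ord_A] by blast
  qed
qed

lemma V_cofinal:
  assumes "ord w"
  shows "\<exists>b. ord b \<and> w \<preceq> b \<and> x \<in> V b"
proof -
  obtain b where "ord b" "x \<in> V b" using in_some_V by blast
  then show ?thesis using ord_le_total[OF assms] V_mono[OF assms] assms ord_le_refl by blast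
qed

end

section \<open>Prenex normal form\<close>

inductive prenex :: "fm \<Rightarrow> bool" where
  Delta0: "Delta0 \<phi> \<Longrightarrow> prenex \<phi>"
| All: "prenex \<phi> \<Longrightarrow> prenex (\<^bold>\<forall>\<phi>)"
| Exi: "prenex \<phi> \<Longrightarrow> prenex (\<^bold>\<exists>\<phi>)"

lemma prenex_imp_Levy_Sigma: "prenex \<phi> \<Longrightarrow> \<exists>n. Levy_Sigma n \<phi>"
  by (induction rule: prenex.induct) (blast intro: Levy_Sigma_Levy_Pi.intros)+

lemma Delta0_rename: "Delta0 \<phi> \<Longrightarrow> Delta0 (rename r \<phi>)"
  by (induction arbitrary: r rule: Delta0.induct) (auto intro: Delta0.intros)

lemma prenex_rename: "prenex \<phi> \<Longrightarrow> prenex (rename r \<phi>)"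
  by (induction arbitrary: r rule: prenex.induct) (auto intro: prenex.intros Delta0_rename)

definition equivalent :: "'a itself \<Rightarrow> fm \<Rightarrow> fm \<Rightarrow> bool" where
  "equivalent _ \<phi> \<psi> \<longleftrightarrow> (\<forall>(D :: 'a set) E e. D \<noteq> {} \<longrightarrow> sat D E e \<phi> = sat D E e \<psi>)"

lemma equivalent_refl: "equivalent TYPE('a) \<phi> \<phi>"
  unfolding equivalent_def by simp

lemma equivalent_trans:
  "equivalent TYPE('a) \<phi> \<psi> \<Longrightarrow> equivalent TYPE('a) \<psi> \<chi> \<Longrightarrow> equivalent TYPE('a) \<phi> \<chi>"
  unfolding equivalent_def by auto

lemma equivalent_Imp:
  "equivalent TYPE('a) \<phi> \<phi>' \<Longrightarrow> equivalent TYPE('a) \<psi> \<psi>' \<Longrightarrow>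
    equivalent TYPE('a) (\<phi> \<^bold>\<longrightarrow> \<psi>) (\<phi>' \<^bold>\<longrightarrow> \<psi>')"
  unfolding equivalent_def by auto

lemma equivalent_All: "equivalent TYPE('a) \<phi> \<psi> \<Longrightarrow> equivalent TYPE('a) (\<^bold>\<forall>\<phi>) (\<^bold>\<forall>\<psi>)"
  unfolding equivalent_def by auto

lemma equivalent_Exi: "equivalent TYPE('a) \<phi> \<psi> \<Longrightarrow> equivalent TYPE('a) (\<^bold>\<exists>\<phi>) (\<^bold>\<exists>\<psi>)"
  unfolding equivalent_def by auto

lemma equivalent_pull_quantifier:
  "equivalent TYPE('a) (\<phi> \<^bold>\<longrightarrow> \<^bold>\<forall>\<psi>) (\<^bold>\<forall>(rename Suc \<phi> \<^bold>\<longrightarrow> \<psi>))"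
  "equivalent TYPE('a) (\<phi> \<^bold>\<longrightarrow> \<^bold>\<exists>\<psi>) (\<^bold>\<exists>(rename Suc \<phi> \<^bold>\<longrightarrow> \<psi>))"
  "equivalent TYPE('a) (\<^bold>\<forall>\<phi> \<^bold>\<longrightarrow> \<psi>) (\<^bold>\<exists>(\<phi> \<^bold>\<longrightarrow> rename Suc \<psi>))"
  "equivalent TYPE('a) (\<^bold>\<exists>\<phi> \<^bold>\<longrightarrow> \<psi>) (\<^bold>\<forall>(\<phi> \<^bold>\<longrightarrow> rename Suc \<psi>))"
  unfolding equivalent_def by (auto simp: sat_rename)

lemma prenex_Imp_Delta0:
  "prenex \<psi> \<Longrightarrow> Delta0 \<phi> \<Longrightarrow> \<exists>\<chi>. prenex \<chi> \<and> equivalent TYPE('a) (\<phi> \<^bold>\<longrightarrow> \<psi>) \<chi>"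
proof (induction arbitrary: \<phi> rule: prenex.induct)
  case (Delta0 \<psi>)
  then show ?case using equivalent_refl by (blast intro: prenex.intros Delta0.intros)
next
  case (All \<psi>)
  then obtain \<chi> where "prenex \<chi>" "equivalent TYPE('a) (rename Suc \<phi> \<^bold>\<longrightarrow> \<psi>) \<chi>"
    using Delta0_rename by blast
  then show ?case
    using equivalent_trans[OF equivalent_pull_quantifier(1) equivalent_All] prenex.All by blast
next
  case (Exi \<psi>)
  then obtain \<chi> where "prenex \<chi>" "equivalent TYPE('a) (rename Suc \<phi> \<^bold>\<longrightarrow> \<psi>) \<chi>"
    using Delta0_rename by blast
  then show ?case
    using equivalent_trans[OF equivalent_pull_quantifier(2) equivalent_Exi] prenex.Exi by blast
qed

lemma prenex_Imp:
  "prenex \<phi> \<Longrightarrow> prenex \<psi> \<Longrightarrow> \<exists>\<chi>. prenex \<chi> \<and> equivalent TYPE('a) (\<phi> \<^bold>\<longrightarrow> \<psi>) \<chi>"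
proof (induction arbitrary: \<psi> rule: prenex.induct)
  case (Delta0 \<phi>)
  then show ?case using prenex_Imp_Delta0 by blast
next
  case (All \<phi>)
  then obtain \<chi> where "prenex \<chi>" "equivalent TYPE('a) (\<phi> \<^bold>\<longrightarrow> rename Suc \<psi>) \<chi>"
    using prenex_rename by blast
  then show ?case
    using equivalent_trans[OF equivalent_pull_quantifier(3) equivalent_Exi] prenex.Exi by blast
next
  case (Exi \<phi>)
  then obtain \<chi> where "prenex \<chi>" "equivalent TYPE('a) (\<phi> \<^bold>\<longrightarrow> rename Suc \<psi>) \<chi>"
    using prenex_rename by blast
  then show ?case
    using equivalent_trans[OF equivalent_pull_quantifier(4) equivalent_All] prenex.All by blast
qed

theorem prenex_normal_form: "\<exists>\<chi>. prenex \<chi> \<and> equivalent TYPE('a) \<phi> \<chi>"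
proof (induction \<phi>)
  case (Imp \<phi> \<psi>)
  then obtain \<phi>' \<psi>' where "prenex \<phi>'" "prenex \<psi>'"
    and equiv: "equivalent TYPE('a) \<phi> \<phi>'" "equivalent TYPE('a) \<psi> \<psi>'"
    by blast
  then obtain \<chi> where "prenex \<chi>" "equivalent TYPE('a) (\<phi>' \<^bold>\<longrightarrow> \<psi>') \<chi>" using prenex_Imp by blast
  then show ?case using equivalent_trans[OF equivalent_Imp[OF equiv]] by blast
next
  case (All \<phi>)
  then show ?case using equivalent_All prenex.All by blast
qed (blast intro: equivalent_refl prenex.Delta0 Delta0.intros)+

section \<open>Rank potentialism in a model of ZFC\<close>

lemma bounded_assignments_iff:
  assumes "A \<noteq> {}" and local: "\<And>e e'. (\<And>i. i < k \<Longrightarrow> e i = e' i) \<Longrightarrow> P e \<longleftrightarrow> P e'"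
  shows "(\<forall>e :: nat \<Rightarrow> 'a. (\<forall>i<k. e i \<in> A) \<longrightarrow> P e) \<longleftrightarrow> (\<forall>e. range e \<subseteq> A \<longrightarrow> P e)"
proof (intro iffI allI impI)
  fix e :: "nat \<Rightarrow> 'a"
  assume all: "\<forall>e. range e \<subseteq> A \<longrightarrow> P e" and e: "\<forall>i<k. e i \<in> A"
  obtain c where "c \<in> A" using assms(1) by blast
  then have "P (\<lambda>i. if i < k then e i else c)" using all e by (simp add: image_subset_iff)
  then show "P e" using local[of e "\<lambda>i. if i < k then e i else c"] by simp
qed auto

definition append_env :: "nat \<Rightarrow> (nat \<Rightarrow> 'a) \<Rightarrow> (nat \<Rightarrow> 'a) \<Rightarrow> nat \<Rightarrow> 'a" where
  "append_env k e s i = (if i < k then e i else s (i - k))"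

lemma append_env_Suc: "append_env k e (case_nat x s) = append_env (Suc k) (e(k := x)) s"
  by (auto simp: append_env_def fun_eq_iff split: nat.split intro!: arg_cong[of _ _ s])

context zfc
begin

primrec holds_at :: "mfm \<Rightarrow> (nat \<Rightarrow> 'a) \<Rightarrow> 'a \<Rightarrow> bool" where
  "holds_at (MMem x y) e w = (e x \<epsilon> e y)"
| "holds_at (MEq x y) e w = (e x = e y)"
| "holds_at MFls e w = False"
| "holds_at (MImp \<phi> \<psi>) e w = (holds_at \<phi> e w \<longrightarrow> holds_at \<psi> e w)"
| "holds_at (MAll \<phi>) e w = (\<forall>x\<in>V w. holds_at \<phi> (case_nat x e) w)"
| "holds_at (MBox \<phi>) e w = (\<forall>u. ord u \<and> w \<preceq> u \<longrightarrow> holds_at \<phi> e u)"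

lemma satisfies_true_at: "e \<Turnstile> true_at \<phi> f w \<longleftrightarrow> holds_at \<phi> (\<lambda>i. e (f i)) (e w)"
proof (induction \<phi> arbitrary: e f w)
  case (MAll \<phi>)
  have "(\<lambda>i. case_nat x e (case_nat 0 (\<lambda>i. Suc (f i)) i)) = case_nat x (\<lambda>i. e (f i))" for x
    by (auto split: nat.split)
  then show ?case by (auto simp: MAll satisfies_in_V_fm)
next
  case (MBox \<phi>)
  then show ?case by (auto simp: satisfies_ord_fm satisfies_le_fm)
qed auto

lemma holds_at_cong: "(\<And>i. i \<in> mfv \<phi> \<Longrightarrow> e i = e' i) \<Longrightarrow> holds_at \<phi> e w = holds_at \<phi> e' w"
proof (induction \<phi> arbitrary: e e' w)
  case (MImp \<phi> \<psi>)
  have "holds_at \<phi> e w = holds_at \<phi> e' w" "holds_at \<psi> e w = holds_at \<psi> e' w"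
    using MImp.prems by (auto intro!: MImp.IH)
  then show ?case by simp
next
  case (MAll \<phi>)
  have "holds_at \<phi> (case_nat x e) w = holds_at \<phi> (case_nat x e') w" for x
    using MAll.prems by (intro MAll.IH) (auto split: nat.split)
  then show ?case by simp
next
  case (MBox \<phi>)
  have "holds_at \<phi> e u = holds_at \<phi> e' u" for u using MBox.prems by (intro MBox.IH) auto
  then show ?case by simp
qed auto

lemma satisfies_params_in_V:
  "s \<Turnstile> params_in_V k d \<phi> \<longleftrightarrow> (\<forall>e. (\<forall>i<k. e i \<in> V (s d)) \<longrightarrow> append_env k e s \<Turnstile> \<phi>)"
proof (induction k arbitrary: s d)
  case 0
  show ?case by (simp add: append_env_def)
next
  case (Suc k)
  have "s \<Turnstile> params_in_V (Suc k) d \<phi> \<longleftrightarrow> (\<forall>x\<in>V (s d). \<forall>e. (\<forall>i<k. e i \<in> V (s d)) \<longrightarrow>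
      append_env (Suc k) (e(k := x)) s \<Turnstile> \<phi>)"
    by (auto simp: satisfies_in_V_fm Suc.IH append_env_Suc)
  also have "\<dots> \<longleftrightarrow> (\<forall>e. (\<forall>i<Suc k. e i \<in> V (s d)) \<longrightarrow> append_env (Suc k) e s \<Turnstile> \<phi>)"
  proof (intro iffI allI impI ballI)
    fix e assume "\<forall>x\<in>V (s d). \<forall>e. (\<forall>i<k. e i \<in> V (s d)) \<longrightarrow> append_env (Suc k) (e(k := x)) s \<Turnstile> \<phi>"
      and "\<forall>i<Suc k. e i \<in> V (s d)"
    then show "append_env (Suc k) e s \<Turnstile> \<phi>" by (metis fun_upd_triv less_Suc_eq)
  qed (simp add: less_Suc_eq)
  finally show ?case .
qed

lemma satisfies_relativize: "e \<Turnstile> relativize \<phi> d \<longleftrightarrow> sat (V (e d)) (\<epsilon>) e \<phi>"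
  by (induction \<phi> arbitrary: e d) (auto simp: satisfies_in_V_fm)

lemma satisfies_true_at_V:
  assumes "mfv \<psi> \<subseteq> {..<k}"
  shows "s \<Turnstile> true_at_V k \<psi> \<longleftrightarrow> (\<forall>e. (\<forall>i<k. e i \<in> V (s 0)) \<longrightarrow> holds_at \<psi> e (s 0))"
proof -
  have "holds_at \<psi> (append_env k e s) (s 0) \<longleftrightarrow> holds_at \<psi> e (s 0)" for e
    using assms by (intro holds_at_cong) (auto simp: append_env_def)
  moreover have "append_env k e s k = s 0" for e by (simp add: append_env_def)
  ultimately show ?thesis
    unfolding true_at_V_def satisfies_params_in_V satisfies_true_at by simp
qed

lemma satisfies_elementary_instance:
  assumes "fv \<phi> \<subseteq> {..<k}"
  shows "s \<Turnstile> params_in_V k 0 (\<phi> \<^bold>\<longleftrightarrow> relativize \<phi> k) \<longleftrightarrow>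
    (\<forall>e. (\<forall>i<k. e i \<in> V (s 0)) \<longrightarrow> (e \<Turnstile> \<phi> \<longleftrightarrow> sat (V (s 0)) (\<epsilon>) e \<phi>))"
proof -
  have "sat D (\<epsilon>) (append_env k e s) \<phi> \<longleftrightarrow> sat D (\<epsilon>) e \<phi>" for e D
    using assms by (intro sat_cong) (auto simp: append_env_def)
  moreover have "append_env k e s k = s 0" for e by (simp add: append_env_def)
  ultimately show ?thesis unfolding satisfies_params_in_V sat_Iff satisfies_relativize by simp
qed

subsection \<open>Elementary levels of the hierarchy\<close>

definition elementary :: "'a \<Rightarrow> bool" where
  "elementary \<delta> \<longleftrightarrow> V \<delta> \<noteq> {} \<and>
     (\<forall>\<phi> e. range e \<subseteq> V \<delta> \<longrightarrow> (e \<Turnstile> \<phi> \<longleftrightarrow> sat (V \<delta>) (\<epsilon>) e \<phi>))"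

lemma elementaryD:
  "elementary \<delta> \<Longrightarrow> range e \<subseteq> V \<delta> \<Longrightarrow> e \<Turnstile> \<phi> \<longleftrightarrow> sat (V \<delta>) (\<epsilon>) e \<phi>"
  unfolding elementary_def by blast

lemma elementary_satisfies_correct_scheme:
  assumes "elementary (s 0)" "\<psi> \<in> correct_scheme"
  shows "s \<Turnstile> \<psi>"
proof -
  obtain k \<phi> where \<psi>: "\<psi> = params_in_V k 0 (\<phi> \<^bold>\<longleftrightarrow> relativize \<phi> k)" and k: "fv \<phi> \<subseteq> {..<k}"
    using assms(2) unfolding correct_scheme_def elementary_scheme_def by blast
  have "sat D (\<epsilon>) e \<phi> \<longleftrightarrow> sat D (\<epsilon>) e' \<phi>" if "\<And>i. i < k \<Longrightarrow> e i = e' i" for D e e'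
    using that k by (intro sat_cong) auto
  then show ?thesis
    using assms(1) unfolding \<psi> satisfies_elementary_instance[OF k] elementary_def
    by (subst bounded_assignments_iff) blast+
qed

lemma elementary_if_satisfies_correct_scheme:
  assumes "\<forall>\<psi>\<in>correct_scheme. s \<Turnstile> \<psi>"
  shows "elementary (s 0)"
proof -
  have inst: "e \<Turnstile> \<phi> \<longleftrightarrow> sat (V (s 0)) (\<epsilon>) e \<phi>"
    if "Levy_Sigma n \<phi>" "fv \<phi> \<subseteq> {..<k}" "\<forall>i<k. e i \<in> V (s 0)" for n k \<phi> e
  proof -
    have "params_in_V k 0 (\<phi> \<^bold>\<longleftrightarrow> relativize \<phi> k) \<in> correct_scheme"
      unfolding correct_scheme_def elementary_scheme_def using that(1,2) by blast
    then show ?thesis using assms satisfies_elementary_instance[OF that(2)] that(3) by blast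
  qed
  have "Levy_Sigma (Suc 0) (\<^bold>\<exists>(0 \<^bold>= 0))"
    by (intro Levy_Sigma_Levy_Pi.intros Delta0.intros)
  from inst[OF this, of 0 s] have nonempty: "V (s 0) \<noteq> {}" by auto
  have "e \<Turnstile> \<phi> \<longleftrightarrow> sat (V (s 0)) (\<epsilon>) e \<phi>" if "range e \<subseteq> V (s 0)" for e \<phi>
  proof -
    obtain \<chi> where \<chi>: "prenex \<chi>" "equivalent TYPE('a) \<phi> \<chi>" using prenex_normal_form by blast
    obtain n where "Levy_Sigma n \<chi>" using prenex_imp_Levy_Sigma \<chi>(1) by blast
    moreover obtain k where "fv \<chi> \<subseteq> {..<k}" using fv_bounded by blast
    ultimately have "e \<Turnstile> \<chi> \<longleftrightarrow> sat (V (s 0)) (\<epsilon>) e \<chi>" using inst that by blast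
    then show ?thesis using \<chi>(2) nonempty unfolding equivalent_def by blast
  qed
  then show ?thesis using nonempty unfolding elementary_def by blast
qed

text \<open>The statement that \<open>\<phi>\<close> holds at some \<open>V\<^sub>\<gamma>\<close> with \<open>\<gamma> \<ge> \<alpha>\<close> is true for all \<open>\<alpha> < \<delta>\<close>, hence, by
  elementarity, for all ordinals \<open>\<alpha>\<close>.\<close>

lemma elementary_holds_at_cofinal:
  assumes \<delta>: "ord \<delta>" "elementary \<delta>" and e: "range e \<subseteq> V \<delta>"
    and u: "ord u" "\<delta> \<preceq> u" "holds_at \<phi> e u" and a: "ord a"
  shows "\<exists>v. ord v \<and> a \<preceq> v \<and> holds_at \<phi> e v"
proof -
  define \<chi> where "\<chi> = \<^bold>\<exists>(ord_fm 0 \<^bold>\<and> le_fm 1 0 \<^bold>\<and> true_at \<phi> (\<lambda>i. i + 2) 0)"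
  have \<chi>: "case_nat b e \<Turnstile> \<chi> \<longleftrightarrow> (\<exists>v. ord v \<and> b \<preceq> v \<and> holds_at \<phi> e v)" for b
    by (simp add: \<chi>_def satisfies_ord_fm satisfies_le_fm satisfies_true_at)
  have "sat (V \<delta>) (\<epsilon>) (case_nat b e) (ord_fm 0 \<^bold>\<longrightarrow> \<chi>)" if "b \<in> V \<delta>" for b
  proof -
    have "range (case_nat b e) \<subseteq> V \<delta>" using e that by (auto split: nat.split simp: image_subset_iff)
    moreover have "b \<preceq> u" if "ord b"
      using ord_in_V_imp_mem[OF that \<delta>(1) \<open>b \<in> V \<delta>\<close>] ord_le_trans[OF u(1) _ u(2)]
      unfolding ord_le_def by blast
    then have "case_nat b e \<Turnstile> ord_fm 0 \<^bold>\<longrightarrow> \<chi>" using u(1,3) by (auto simp: satisfies_ord_fm \<chi>)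
    ultimately show ?thesis using elementaryD[OF \<delta>(2)] by blast
  qed
  then have "e \<Turnstile> \<^bold>\<forall>(ord_fm 0 \<^bold>\<longrightarrow> \<chi>)" unfolding elementaryD[OF \<delta>(2) e] by simp
  then show ?thesis using a by (simp add: satisfies_ord_fm \<chi>)
qed

subsection \<open>S5 at elementary levels\<close>

lemma elementary_holds_at_S5:
  assumes \<delta>: "ord \<delta>" "elementary \<delta>" and e: "range e \<subseteq> V \<delta>" and "p \<in> S5"
  shows "ord u \<Longrightarrow> \<delta> \<preceq> u \<Longrightarrow> holds_at (psubst \<sigma> p) e u"
  using assms(4)
proof (induction arbitrary: u rule: S5.induct)
  case (Five p)
  have "\<exists>v'. ord v' \<and> w \<preceq> v' \<and> holds_at (psubst \<sigma> p) e v'"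
    if v: "ord v" "u \<preceq> v" "holds_at (psubst \<sigma> p) e v" and "ord w" for v w
  proof -
    have "\<delta> \<preceq> v" using ord_le_trans v(1,2) Five.prems(2) by blast
    then show ?thesis using elementary_holds_at_cofinal[OF \<delta> e v(1) _ v(3)] that(4) by blast
  qed
  then show ?case by (simp; blast)
next
  case (Nec p)
  have "holds_at (psubst \<sigma> p) e v" if "ord v" "u \<preceq> v" for v
    using Nec.IH[OF that(1)] ord_le_trans[OF that(1) Nec.prems(2) that(2)] by blast
  then show ?case by simp
qed auto

lemma elementary_satisfies_S5_scheme:
  assumes \<delta>: "ord (s 0)" "elementary (s 0)" and "\<psi> \<in> S5_scheme"
  shows "s \<Turnstile> \<psi>"
proof -
  obtain p k \<sigma> where p: "p \<in> S5" and k: "mfv (psubst \<sigma> p) \<subseteq> {..<k}"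
    and \<psi>: "\<psi> = true_at_V k (psubst \<sigma> p)"
    using assms(3) unfolding S5_scheme_def validity_scheme_def by blast
  have "holds_at (psubst \<sigma> p) e w = holds_at (psubst \<sigma> p) e' w"
    if "\<And>i. i < k \<Longrightarrow> e i = e' i" for e e' w
    using that k by (intro holds_at_cong) auto
  moreover have "V (s 0) \<noteq> {}" using \<delta>(2) unfolding elementary_def by blast
  moreover have "holds_at (psubst \<sigma> p) e (s 0)" if "range e \<subseteq> V (s 0)" for e
    using elementary_holds_at_S5[OF \<delta> that p \<delta>(1)] by simp
  ultimately show ?thesis
    unfolding \<psi> satisfies_true_at_V[OF k] by (subst bounded_assignments_iff) blast+
qed

end

subsection \<open>Tarski--Vaught from S5\<close>

primrec potential :: "fm \<Rightarrow> mfm" where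
  "potential (x \<^bold>\<in> y) = MMem x y"
| "potential (x \<^bold>= y) = MEq x y"
| "potential \<^bold>\<bottom> = MFls"
| "potential (\<phi> \<^bold>\<longrightarrow> \<psi>) = MImp (potential \<phi>) (potential \<psi>)"
| "potential (\<^bold>\<forall>\<phi>) = MBox (MAll (potential \<phi>))"

lemma mfv_potential: "mfv (potential \<phi>) = fv \<phi>"
  by (induction \<phi>) auto

context zfc
begin

lemma holds_at_potential: "ord w \<Longrightarrow> holds_at (potential \<phi>) e w \<longleftrightarrow> e \<Turnstile> \<phi>"
proof (induction \<phi> arbitrary: e w)
  case (All \<phi>)
  have "holds_at (potential (\<^bold>\<forall>\<phi>)) e w \<longleftrightarrow>
      (\<forall>u. ord u \<and> w \<preceq> u \<longrightarrow> (\<forall>x\<in>V u. case_nat x e \<Turnstile> \<phi>))"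
    using All.IH by auto
  also have "\<dots> \<longleftrightarrow> (\<forall>x. case_nat x e \<Turnstile> \<phi>)" using V_cofinal[OF All.prems] by blast
  finally show ?case by simp
qed auto

lemma S5_scheme_counterexample_in_V:
  assumes S5: "\<forall>\<psi>\<in>S5_scheme. s \<Turnstile> \<psi>" and \<delta>: "ord (s 0)"
    and k: "fv (\<^bold>\<forall>\<phi>) \<subseteq> {..<k}" and e: "\<forall>i<k. e i \<in> V (s 0)" and x: "\<not> case_nat x e \<Turnstile> \<phi>"
  shows "\<exists>y\<in>V (s 0). \<not> case_nat y e \<Turnstile> \<phi>"
proof -
  define \<psi> where "\<psi> = MImp (MAll (potential \<phi>)) MFls"
  have \<psi>: "holds_at \<psi> e u \<longleftrightarrow> (\<exists>y\<in>V u. \<not> case_nat y e \<Turnstile> \<phi>)" if "ord u" for u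
    unfolding \<psi>_def using holds_at_potential that by simp
  let ?p = "PImp (PDia (PBox (PAtom 0))) (PAtom 0)"
  have fv: "mfv (psubst (\<lambda>_. \<psi>) ?p) \<subseteq> {..<k}" using k by (simp add: \<psi>_def mfv_potential)
  then have "true_at_V k (psubst (\<lambda>_. \<psi>) ?p) \<in> S5_scheme"
    unfolding S5_scheme_def validity_scheme_def using S5_PDia_PBox by blast
  then have "s \<Turnstile> true_at_V k (psubst (\<lambda>_. \<psi>) ?p)" using S5 by blast
  then have dia_box: "holds_at (psubst (\<lambda>_. \<psi>) ?p) e (s 0)"
    unfolding satisfies_true_at_V[OF fv] using e by blast
  obtain u where u: "ord u" "s 0 \<preceq> u" "x \<in> V u" using V_cofinal[OF \<delta>] by blast
  have "holds_at \<psi> e v" if "ord v" "u \<preceq> v" for v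
    unfolding \<psi>[OF that(1)] using x V_mono[OF that] u(3) by blast
  then have "holds_at \<psi> e (s 0)" using dia_box u by auto
  then show ?thesis using \<psi>[OF \<delta>] by blast
qed

lemma elementary_if_Tarski_Vaught:
  assumes "V \<delta> \<noteq> {}"
    and witness: "\<And>e \<phi> x. range e \<subseteq> V \<delta> \<Longrightarrow> \<not> case_nat x e \<Turnstile> \<phi> \<Longrightarrow> \<exists>y\<in>V \<delta>. \<not> case_nat y e \<Turnstile> \<phi>"
  shows "elementary \<delta>"
proof -
  have "e \<Turnstile> \<phi> \<longleftrightarrow> sat (V \<delta>) (\<epsilon>) e \<phi>" if "range e \<subseteq> V \<delta>" for e \<phi>
    using that
  proof (induction \<phi> arbitrary: e)
    case (All \<phi>)
    have "range (case_nat x e) \<subseteq> V \<delta>" if "x \<in> V \<delta>" for x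
      using that All.prems by (auto split: nat.split simp: image_subset_iff)
    then have "(\<forall>x\<in>V \<delta>. sat (V \<delta>) (\<epsilon>) (case_nat x e) \<phi>) \<longleftrightarrow> (\<forall>x\<in>V \<delta>. case_nat x e \<Turnstile> \<phi>)"
      using All.IH by blast
    then show ?case using witness[OF All.prems] by auto
  qed auto
  then show ?thesis using assms(1) unfolding elementary_def by blast
qed

lemma elementary_if_satisfies_S5_scheme:
  assumes "\<forall>\<psi>\<in>S5_scheme. s \<Turnstile> \<psi>" "ord (s 0)"
  shows "elementary (s 0)"
proof (rule elementary_if_Tarski_Vaught)
  show "V (s 0) \<noteq> {}" using S5_scheme_counterexample_in_V[OF assms, of "\<^bold>\<bottom>" 0] by auto
next
  fix e \<phi> x assume e: "range e \<subseteq> V (s 0)" and x: "\<not> case_nat x e \<Turnstile> \<phi>"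
  obtain k where "fv (\<^bold>\<forall>\<phi>) \<subseteq> {..<k}" using fv_bounded by blast
  then show "\<exists>y\<in>V (s 0). \<not> case_nat y e \<Turnstile> \<phi>"
    using S5_scheme_counterexample_in_V[OF assms _ _ x] e by blast
qed

lemma satisfies_S5_scheme_iff_correct_scheme:
  "ord (s 0) \<Longrightarrow> (\<forall>\<psi>\<in>S5_scheme. s \<Turnstile> \<psi>) \<longleftrightarrow> (\<forall>\<psi>\<in>correct_scheme. s \<Turnstile> \<psi>)"
  using elementary_if_satisfies_S5_scheme elementary_satisfies_S5_scheme
    elementary_if_satisfies_correct_scheme elementary_satisfies_correct_scheme
  by blast

text \<open>Labels that all recur cofinally turn the worlds into a copy of a universal frame.\<close>

lemma holds_at_psubst_iff_holds:
  assumes label: "\<And>u. ord u \<Longrightarrow> label u \<in> W"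
    and cofinal: "\<And>v u. v \<in> W \<Longrightarrow> ord u \<Longrightarrow> \<exists>u'. ord u' \<and> u \<preceq> u' \<and> label u' = v"
    and \<sigma>: "\<And>i u. ord u \<Longrightarrow> holds_at (\<sigma> i) e u \<longleftrightarrow> i \<in> label u"
  shows "ord u \<Longrightarrow> holds_at (psubst \<sigma> p) e u \<longleftrightarrow> holds W (label u) p"
proof (induction p arbitrary: u)
  case (PBox p)
  have "holds_at (psubst \<sigma> (PBox p)) e u \<longleftrightarrow> (\<forall>u'. ord u' \<and> u \<preceq> u' \<longrightarrow> holds W (label u') p)"
    using PBox.IH by auto
  also have "\<dots> \<longleftrightarrow> (\<forall>v\<in>W. holds W v p)" using label cofinal[OF _ PBox.prems] by blast
  finally show ?case by simp
qed (auto simp: \<sigma>)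

end

subsection \<open>A dial\<close>

abbreviation MNeg :: "mfm \<Rightarrow> mfm" where
  "MNeg \<phi> \<equiv> MImp \<phi> MFls"

abbreviation MBool :: "bool \<Rightarrow> mfm" where
  "MBool b \<equiv> if b then MNeg MFls else MFls"

abbreviation MCon :: "mfm \<Rightarrow> mfm \<Rightarrow> mfm" where
  "MCon \<phi> \<psi> \<equiv> MNeg (MImp \<phi> (MNeg \<psi>))"

abbreviation MExi :: "mfm \<Rightarrow> mfm" where
  "MExi \<phi> \<equiv> MNeg (MAll (MNeg \<phi>))"

text \<open>\<open>chain_fm k\<close>: some \<open>\<in>\<close>-chain of length \<open>k\<close> starts at the variable 0.\<close>

primrec chain_fm :: "nat \<Rightarrow> mfm" where
  "chain_fm 0 = MNeg MFls"
| "chain_fm (Suc k) = MExi (MCon (MMem (Suc 0) 0) (chain_fm k))"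

definition maximal_chain_fm :: "nat \<Rightarrow> mfm" where
  "maximal_chain_fm m = MExi (MCon (chain_fm m) (MNeg (chain_fm (Suc m))))"

text \<open>If \<open>j \<le> n\<close> is the largest number with \<open>j = 0\<close> or \<open>maximal_chain_fm (j - 1)\<close> at the current
  world, then \<open>dial_fm b n\<close> says \<open>b j\<close>.\<close>

primrec dial_fm :: "(nat \<Rightarrow> bool) \<Rightarrow> nat \<Rightarrow> mfm" where
  "dial_fm b 0 = MBool (b 0)"
| "dial_fm b (Suc m) = MCon (MImp (maximal_chain_fm m) (MBool (b (Suc m))))
     (MImp (MNeg (maximal_chain_fm m)) (dial_fm b m))"

definition dial_subst :: "nat set list \<Rightarrow> nat \<Rightarrow> mfm" where
  "dial_subst ws i = dial_fm (\<lambda>j. i \<in> ws ! j) (length ws - 1)"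

lemma mfv_chain_fm: "mfv (chain_fm k) \<subseteq> {0}"
  by (induction k) auto

lemma mfv_maximal_chain_fm: "mfv (maximal_chain_fm m) = {}"
  using mfv_chain_fm[of m] mfv_chain_fm[of "Suc m"] unfolding maximal_chain_fm_def by auto

lemma mfv_dial_fm: "mfv (dial_fm b m) = {}"
  by (induction m) (auto simp: mfv_maximal_chain_fm)

lemma mfv_psubst_closed: "(\<And>i. mfv (\<sigma> i) = {}) \<Longrightarrow> mfv (psubst \<sigma> p) = {}"
  by (induction p) auto

context zfc
begin

primrec dial :: "nat \<Rightarrow> 'a \<Rightarrow> nat" where
  "dial 0 w = 0"
| "dial (Suc m) w = (if holds_at (maximal_chain_fm m) (\<lambda>_. emptyset) w then Suc m else dial m w)"

lemma dial_le: "dial m w \<le> m"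
  by (induction m) auto

lemma holds_at_dial_fm: "holds_at (dial_fm b m) e w \<longleftrightarrow> b (dial m w)"
proof (induction m)
  case (Suc m)
  have "holds_at (maximal_chain_fm m) e w \<longleftrightarrow> holds_at (maximal_chain_fm m) (\<lambda>_. emptyset) w"
    by (rule holds_at_cong) (simp add: mfv_maximal_chain_fm)
  then show ?case using Suc by auto
qed simp

lemma ord_funpow_succ: "ord a \<Longrightarrow> ord ((succ ^^ j) a)"
  by (induction j) (auto simp: ord_succ)

lemma funpow_succ_mono:
  assumes "ord a"
  shows "i \<le> j \<Longrightarrow> (succ ^^ i) a \<preceq> (succ ^^ j) a"
proof (induction rule: dec_induct)
  case (step j)
  then show ?case using ord_le_trans[OF ord_funpow_succ[OF assms, of "Suc j"]] ord_le_succ by simp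
qed simp

definition limit_level :: "'a \<Rightarrow> bool" where
  "limit_level \<delta> \<longleftrightarrow> (\<forall>x\<in>V \<delta>. \<exists>y\<in>V \<delta>. x \<epsilon> y)"

text \<open>For a limit \<open>\<delta>\<close>, the elements of \<open>V\<^bsub>\<delta>+j\<^esub>\<close> that start an \<open>\<in>\<close>-chain of length \<open>k\<close> inside it
  form \<open>V\<^bsub>\<delta>+(j-k)\<^esub>\<close> (truncated subtraction), because \<open>\<Union>V\<^bsub>\<beta>+1\<^esub> = V\<^bsub>\<beta>\<^esub>\<close> and \<open>\<Union>V\<^bsub>\<delta>\<^esub> = V\<^bsub>\<delta>\<^esub>\<close>.\<close>

lemma holds_at_chain_fm:
  assumes \<delta>: "ord \<delta>" "limit_level \<delta>"
  shows "x \<in> V ((succ ^^ j) \<delta>) \<Longrightarrow>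
    holds_at (chain_fm k) (case_nat x e) ((succ ^^ j) \<delta>) \<longleftrightarrow> x \<in> V ((succ ^^ (j - k)) \<delta>)"
proof (induction k arbitrary: x e)
  case (Suc k)
  have "V ((succ ^^ (j - k)) \<delta>) \<subseteq> V ((succ ^^ j) \<delta>)"
    using V_mono[OF ord_funpow_succ[OF \<delta>(1)] funpow_succ_mono[OF \<delta>(1), of "j - k" j]] by simp
  then have "holds_at (chain_fm (Suc k)) (case_nat x e) ((succ ^^ j) \<delta>) \<longleftrightarrow>
      (\<exists>y. x \<epsilon> y \<and> y \<in> V ((succ ^^ (j - k)) \<delta>))"
    using Suc.IH by auto
  also have "\<dots> \<longleftrightarrow> x \<in> V ((succ ^^ (j - Suc k)) \<delta>)"
  proof (cases "j - k")
    case 0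
    have "(\<exists>y. x \<epsilon> y \<and> y \<in> V \<delta>) \<longleftrightarrow> x \<in> V \<delta>"
      using \<delta> V_transitive unfolding limit_level_def by blast
    then show ?thesis using 0 by simp
  next
    case (Suc i)
    have "ord ((succ ^^ i) \<delta>)" using \<delta>(1) by (rule ord_funpow_succ)
    then have "(\<exists>y. x \<epsilon> y \<and> y \<in> V (succ ((succ ^^ i) \<delta>))) \<longleftrightarrow> x \<in> V ((succ ^^ i) \<delta>)"
      using in_V_succ_iff mem_upair_iff by metis
    moreover have "j - Suc k = i" using Suc by simp
    ultimately show ?thesis using Suc by simp
  qed
  finally show ?case .
qed simp

lemma holds_at_maximal_chain_fm:
  assumes \<delta>: "ord \<delta>" "limit_level \<delta>"
  shows "holds_at (maximal_chain_fm m) e ((succ ^^ j) \<delta>) \<longleftrightarrow> m < j"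
proof -
  have "holds_at (maximal_chain_fm m) e ((succ ^^ j) \<delta>) \<longleftrightarrow> (\<exists>x\<in>V ((succ ^^ j) \<delta>).
      x \<in> V ((succ ^^ (j - m)) \<delta>) \<and> x \<notin> V ((succ ^^ (j - Suc m)) \<delta>))"
    unfolding maximal_chain_fm_def using holds_at_chain_fm[OF assms]
    by (simp del: chain_fm.simps)
  also have "\<dots> \<longleftrightarrow> m < j"
  proof (cases "m < j")
    case True
    let ?b = "(succ ^^ (j - Suc m)) \<delta>"
    have b: "ord ?b" by (rule ord_funpow_succ[OF \<delta>(1)])
    have "j - m = Suc (j - Suc m)" using True by simp
    then have "?b \<in> V ((succ ^^ (j - m)) \<delta>)" using mem_ord_imp_in_V[OF ord_succ[OF b]] by simp
    moreover from this have "?b \<in> V ((succ ^^ j) \<delta>)"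
      using V_mono[OF ord_funpow_succ[OF \<delta>(1)] funpow_succ_mono[OF \<delta>(1), of "j - m" j]] by auto
    moreover have "?b \<notin> V ?b" using ord_in_V_imp_mem[OF b b] by auto
    ultimately show ?thesis using True by blast
  qed simp
  finally show ?thesis .
qed

lemma dial_funpow_succ:
  assumes "ord \<delta>" "limit_level \<delta>"
  shows "dial m ((succ ^^ j) \<delta>) = min m j"
  by (induction m) (auto simp: holds_at_maximal_chain_fm[OF assms] min_def)

lemma elementary_imp_limit_level:
  assumes "elementary \<delta>"
  shows "limit_level \<delta>"
  unfolding limit_level_def
proof
  fix x assume "x \<in> V \<delta>"
  then have "(\<lambda>_. x) \<Turnstile> \<^bold>\<exists>(1 \<^bold>\<in> 0) \<longleftrightarrow> sat (V \<delta>) (\<epsilon>) (\<lambda>_. x) (\<^bold>\<exists>(1 \<^bold>\<in> 0))"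
    by (intro elementaryD[OF assms]) auto
  moreover have "\<exists>y. x \<epsilon> y" using mem_upair_iff by blast
  ultimately show "\<exists>y\<in>V \<delta>. x \<epsilon> y" by auto
qed

lemma elementary_dial_cofinal:
  assumes \<delta>: "ord \<delta>" "elementary \<delta>" and "j \<le> n" "ord u"
  shows "\<exists>v. ord v \<and> u \<preceq> v \<and> dial n v = j"
proof -
  obtain c where c: "c \<in> V \<delta>" using \<delta>(2) unfolding elementary_def by blast
  let ?u = "(succ ^^ j) \<delta>"
  have "dial n ?u = j"
    using dial_funpow_succ[OF \<delta>(1) elementary_imp_limit_level[OF \<delta>(2)]] \<open>j \<le> n\<close> by simp
  then have "holds_at (dial_fm (\<lambda>i. i = j) n) (\<lambda>_. c) ?u" unfolding holds_at_dial_fm .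
  moreover have "ord ?u" using \<delta>(1) by (rule ord_funpow_succ)
  moreover have "\<delta> \<preceq> ?u" using funpow_succ_mono[OF \<delta>(1), of 0 j] by simp
  moreover have "range (\<lambda>_. c) \<subseteq> V \<delta>" using c by blast
  ultimately have "\<exists>v. ord v \<and> u \<preceq> v \<and> holds_at (dial_fm (\<lambda>i. i = j) n) (\<lambda>_. c) v"
    using elementary_holds_at_cofinal[OF \<delta> _ _ _ _ \<open>ord u\<close>] by simp
  then show ?thesis unfolding holds_at_dial_fm .
qed

lemma elementary_holds_at_dial_subst:
  assumes \<delta>: "ord \<delta>" "elementary \<delta>"
  shows "holds_at (psubst (dial_subst (w # ws)) p) e \<delta> \<longleftrightarrow> holds (set (w # ws)) w p"
proof -
  define label where "label u = (w # ws) ! dial (length ws) u" for u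
  have "label u \<in> set (w # ws)" for u
    unfolding label_def using dial_le[of "length ws" u] by (intro nth_mem) simp
  moreover have "\<exists>u'. ord u' \<and> u \<preceq> u' \<and> label u' = v" if v: "v \<in> set (w # ws)" and "ord u" for v u
  proof -
    obtain j where "j < length (w # ws)" "v = (w # ws) ! j" using v by (metis in_set_conv_nth)
    then show ?thesis
      using elementary_dial_cofinal[OF \<delta>, of j "length ws" u] \<open>ord u\<close> unfolding label_def by auto
  qed
  moreover have "holds_at (dial_subst (w # ws) i) e u \<longleftrightarrow> i \<in> label u" for i u
    unfolding dial_subst_def holds_at_dial_fm label_def by simp
  ultimately have "holds_at (psubst (dial_subst (w # ws)) p) e \<delta> \<longleftrightarrow> holds (set (w # ws)) (label \<delta>) p"
    using \<delta>(1) by (intro holds_at_psubst_iff_holds)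
  moreover have "label \<delta> = w"
    using dial_funpow_succ[OF \<delta>(1) elementary_imp_limit_level[OF \<delta>(2)], of "length ws" 0]
    by (simp add: label_def)
  ultimately show ?thesis by simp
qed

end

section \<open>The equivalence\<close>

lemma ZFC_ord_completeness:
  assumes valid: "\<And>(E :: nat \<Rightarrow> nat \<Rightarrow> bool) s.
    zfc E \<Longrightarrow> zfc.ord E (s 0) \<Longrightarrow> \<forall>\<psi>\<in>\<Gamma>. sat UNIV E s \<psi> \<Longrightarrow> sat UNIV E s \<phi>"
  shows "ZFC_ord \<union> \<Gamma> \<turnstile> \<phi>"
proof (rule ZFC_completeness)
  show "ZFC \<subseteq> ZFC_ord \<union> \<Gamma>" unfolding ZFC_ord_def by blast
next
  fix E :: "nat \<Rightarrow> nat \<Rightarrow> bool" and s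
  assume model: "\<forall>\<psi>\<in>ZFC_ord \<union> \<Gamma>. sat UNIV E s \<psi>"
  interpret zfc E
  proof
    show "sat UNIV E e \<psi>" if "\<psi> \<in> ZFC" for \<psi> e
      using model that sat_cong[of \<psi> s e] fv_ZFC[OF that] unfolding ZFC_ord_def by auto
  qed
  have "ord (s 0)" using model satisfies_ord_fm unfolding ZFC_ord_def by blast
  then show "sat UNIV E s \<phi>" using valid zfc_axioms model by blast
qed

lemma validity_scheme_refutable:
  assumes "p \<notin> S5"
  shows "\<exists>\<psi>\<in>validity_scheme p. ZFC_ord \<union> correct_scheme \<turnstile> \<^bold>\<not>\<psi>"
proof -
  obtain W w where "finite W" "w \<in> W" and refutes: "\<not> holds W w p"
    using assms by (rule S5_finite_model)
  then obtain ws where W: "W = set (w # ws)" using finite_list[of W] by auto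
  define \<psi> where "\<psi> = psubst (dial_subst (w # ws)) p"
  have closed: "mfv \<psi> \<subseteq> {..<0}"
    unfolding \<psi>_def dial_subst_def by (simp add: mfv_psubst_closed mfv_dial_fm)
  have "ZFC_ord \<union> correct_scheme \<turnstile> \<^bold>\<not>(true_at_V 0 \<psi>)"
  proof (rule ZFC_ord_completeness)
    fix E :: "nat \<Rightarrow> nat \<Rightarrow> bool" and s
    assume "zfc E" and \<delta>: "zfc.ord E (s 0)" and correct: "\<forall>\<psi>\<in>correct_scheme. sat UNIV E s \<psi>"
    interpret zfc E by fact
    have "\<not> holds_at \<psi> s (s 0)"
      using refutes elementary_holds_at_dial_subst[OF \<delta>]
        elementary_if_satisfies_correct_scheme[OF correct]
      unfolding \<psi>_def W by blast
    then show "sat UNIV E s (\<^bold>\<not>(true_at_V 0 \<psi>))" using satisfies_true_at_V[OF closed] by auto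
  qed
  moreover have "true_at_V 0 \<psi> \<in> validity_scheme p"
    using closed unfolding validity_scheme_def \<psi>_def by blast
  ultimately show ?thesis by blast
qed

theorem theorem14:
  shows "(\<forall>\<psi> \<in> S5_scheme. ZFC_ord \<union> correct_scheme \<turnstile> \<psi>) \<and>
         (\<forall>p. p \<notin> S5 \<longrightarrow> (\<exists>\<psi> \<in> validity_scheme p. ZFC_ord \<union> correct_scheme \<turnstile> \<^bold>\<not>\<psi>)) \<and>
         (\<forall>\<psi> \<in> correct_scheme. ZFC_ord \<union> S5_scheme \<turnstile> \<psi>)"
proof (intro conjI ballI allI impI)
  show "ZFC_ord \<union> correct_scheme \<turnstile> \<psi>" if "\<psi> \<in> S5_scheme" for \<psi>
    using that zfc.satisfies_S5_scheme_iff_correct_scheme by (intro ZFC_ord_completeness) blast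
  show "\<exists>\<psi>\<in>validity_scheme p. ZFC_ord \<union> correct_scheme \<turnstile> \<^bold>\<not>\<psi>" if "p \<notin> S5" for p
    using that by (rule validity_scheme_refutable)
  show "ZFC_ord \<union> S5_scheme \<turnstile> \<psi>" if "\<psi> \<in> correct_scheme" for \<psi>
    using that zfc.satisfies_S5_scheme_iff_correct_scheme by (intro ZFC_ord_completeness) blast
qed

end
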